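(* Let $A,B$ be positive operators on a weak-* sequentially complete anti-dual pair $\langle F,E\rangle$. Let $P$ denote the orthogonal projection of $\mathcal H_B$ onto $\mathcal M$. Then $$B_a:=J_B(I-P)J_B^*\qquad\text{and}\qquad B_s:=J_BPJ_B^*$$ are positive operators such that $B=B_a+B_s$, $B_a$ is $A$-absolutely continuous and $B_s$ is $A$-singular. Furthermore, $B_a$ is the greatest element of the set of those positive operators $C\in\mathscr L(E;F)$ such that $C\le B$ and $C\ll A$.
   Context: An anti-dual pair $\langle F,E\rangle$ consists of complex vector spaces $E,F$ and a map $\langle\cdot,\cdot\rangle:F\times E\to\mathbb C$, linear in the first and conjugate linear in the second variable, that separates the points of $E$ and of $F$. $\sigma(F,E)$ is the weak topology on $F$ induced by the functionals $\langle\cdot,x\rangle$ ($x\in E$), and $\sigma(E,F)$ is the weak topology on $E$ induced by the functionals $\langle f,\cdot\rangle$ ($f\in F$). The pair is weak-* sequentially complete if every Cauchy sequence of $(F,\sigma(F,E))$ converges. $\mathscr L(E;F)$ is the set of $\sigma(E,F)$-$\sigma(F,E)$ continuous linear operators $E\to F$. A linear operator $A:E\to F$ is positive if $\langle Ax,x\rangle\ge0$ for all $x\in E$ (such operators belong to $\mathscr L(E;F)$ automatically); $A\le B$ means that $B-A$ is positive. Absolute continuity: $B\ll A$ ($B$ is $A$-absolutely continuous) if for every sequence $(x_n)$ in $E$, $\langle Ax_n,x_n\rangle\to0$ and $\langle B(x_n-x_m),x_n-x_m\rangle\to0$ ($n,m\to\infty$) imply $\langle Bx_n,x_n\rangle\to0$.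 Singularity: $A\perp B$ (also: $B$ is $A$-singular) if $C\le A$ and $C\le B$ imply $C=0$ for every positive $C\in\mathscr L(E;F)$. Auxiliary Hilbert spaces: for a positive $A$, $\mathcal H_A$ is the Hilbert completion of $\operatorname{ran}A$ under the (well-defined) inner product $(Ax\,|\,Ay)_A:=\langle Ax,y\rangle$. $J_A:\mathcal H_A\to F$ is the unique weakly continuous (weak topology of $\mathcal H_A$ to $\sigma(F,E)$) linear extension of the inclusion $\operatorname{ran}A\hookrightarrow F$; its adjoint $J_A^*:E\to\mathcal H_A$, determined by $\langle J_Ah,x\rangle=(h\,|\,J_A^*x)_A$, satisfies $J_A^*x=Ax$, and $A=J_AJ_A^*$. $\mathcal H_B$, $J_B$ are defined likewise. Finally $$\mathcal M:=\{\xi\in\mathcal H_B:\ (0,\xi)\in\overline{\{(Ax,Bx):x\in E\}}\},$$ the closure being taken in $\mathcal H_A\times\mathcal H_B$; $\mathcal M$ is a closed subspace of $\mathcal H_B$. *)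

theory Defs
  imports "HOL-Analysis.Analysis" "HOL-Library.Function_Algebras"
begin

section \<open>Complex vector spaces\<close>

class complex_vector = ab_group_add +
  fixes scaleC :: "complex \<Rightarrow> 'a \<Rightarrow> 'a"  (infixr \<open>*\<^sub>C\<close> 75)
  assumes scaleC_add_right: "a *\<^sub>C (x + y) = a *\<^sub>C x + a *\<^sub>C y"
    and scaleC_add_left: "(a + b) *\<^sub>C x = a *\<^sub>C x + b *\<^sub>C x"
    and scaleC_scaleC: "a *\<^sub>C b *\<^sub>C x = (a * b) *\<^sub>C x"
    and scaleC_one: "1 *\<^sub>C x = x"

global_interpretation complex_vector: vector_space "scaleC :: complex \<Rightarrow> 'a \<Rightarrow> 'a::complex_vector"
  by unfold_locales (simp_all add: scaleC_add_right scaleC_add_left scaleC_scaleC scaleC_one)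

abbreviation clinear :: "('a::complex_vector \<Rightarrow> 'b::complex_vector) \<Rightarrow> bool"
  where "clinear \<equiv> Vector_Spaces.linear (*\<^sub>C) (*\<^sub>C)"

section \<open>Anti-dual pairs\<close>

definition antidual_pair :: "('f::complex_vector \<Rightarrow> 'e::complex_vector \<Rightarrow> complex) \<Rightarrow> bool"
  where "antidual_pair pr \<longleftrightarrow>
    (\<forall>f g x. pr (f + g) x = pr f x + pr g x) \<and>
    (\<forall>c f x. pr (c *\<^sub>C f) x = c * pr f x) \<and>
    (\<forall>f x y. pr f (x + y) = pr f x + pr f y) \<and>
    (\<forall>c f x. pr f (c *\<^sub>C x) = cnj c * pr f x) \<and>
    (\<forall>f. (\<forall>x. pr f x = 0) \<longrightarrow> f = 0) \<and>
    (\<forall>x. (\<forall>f. pr f x = 0) \<longrightarrow> x = 0)"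

text \<open>The initial topology on \<open>S\<close> for a nonempty family \<open>\<Phi>\<close> of scalar functions on \<open>S\<close>.\<close>

definition weak_topology_on :: "'a set \<Rightarrow> ('a \<Rightarrow> complex) set \<Rightarrow> 'a topology"
  where "weak_topology_on S \<Phi> =
    topology_generated_by {{s \<in> S. \<phi> s \<in> U} |\<phi> U. \<phi> \<in> \<Phi> \<and> open U}"

text \<open>\<open>sigmaF pr\<close> is $\sigma(F,E)$, and \<open>sigmaE pr\<close> is $\sigma(E,F)$.\<close>

definition sigmaF :: "('f::complex_vector \<Rightarrow> 'e::complex_vector \<Rightarrow> complex) \<Rightarrow> 'f topology"
  where "sigmaF pr = weak_topology_on UNIV (range (\<lambda>x f. pr f x))"

definition sigmaE :: "('f::complex_vector \<Rightarrow> 'e::complex_vector \<Rightarrow> complex) \<Rightarrow> 'e topology"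
  where "sigmaE pr = weak_topology_on UNIV (range pr)"

definition weak_star_sequentially_complete ::
  "('f::complex_vector \<Rightarrow> 'e::complex_vector \<Rightarrow> complex) \<Rightarrow> bool"
  where "weak_star_sequentially_complete pr \<longleftrightarrow>
    (\<forall>s :: nat \<Rightarrow> 'f.
      (\<forall>U. openin (sigmaF pr) U \<and> 0 \<in> U \<longrightarrow> (\<exists>N. \<forall>m\<ge>N. \<forall>n\<ge>N. s m - s n \<in> U)) \<longrightarrow>
      (\<exists>l. limitin (sigmaF pr) s l sequentially))"

section \<open>Positive operators\<close>

definition weak_operators ::
  "('f::complex_vector \<Rightarrow> 'e::complex_vector \<Rightarrow> complex) \<Rightarrow> ('e \<Rightarrow> 'f) set"
  where "weak_operators pr = {A. clinear A \<and> continuous_map (sigmaE pr) (sigmaF pr) A}"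

definition positive_op ::
  "('f::complex_vector \<Rightarrow> 'e::complex_vector \<Rightarrow> complex) \<Rightarrow> ('e \<Rightarrow> 'f) \<Rightarrow> bool"
  where "positive_op pr A \<longleftrightarrow> clinear A \<and> (\<forall>x. pr (A x) x \<in> \<real>\<^sub>\<ge>\<^sub>0)"

definition op_le ::
  "('f::complex_vector \<Rightarrow> 'e::complex_vector \<Rightarrow> complex) \<Rightarrow> ('e \<Rightarrow> 'f) \<Rightarrow> ('e \<Rightarrow> 'f) \<Rightarrow> bool"
  where "op_le pr A B \<longleftrightarrow> positive_op pr (\<lambda>x. B x - A x)"

text \<open>\<open>abs_cont pr B A\<close> means $B \ll A$.\<close>

definition abs_cont ::
  "('f::complex_vector \<Rightarrow> 'e::complex_vector \<Rightarrow> complex) \<Rightarrow> ('e \<Rightarrow> 'f) \<Rightarrow> ('e \<Rightarrow> 'f) \<Rightarrow> bool"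
  where "abs_cont pr B A \<longleftrightarrow>
    (\<forall>x :: nat \<Rightarrow> 'e.
      (\<lambda>n. pr (A (x n)) (x n)) \<longlonglongrightarrow> 0 \<and>
      ((\<lambda>(n, m). pr (B (x n - x m)) (x n - x m)) \<longlongrightarrow> 0) (sequentially \<times>\<^sub>F sequentially) \<longrightarrow>
      (\<lambda>n. pr (B (x n)) (x n)) \<longlonglongrightarrow> 0)"

definition singular_op ::
  "('f::complex_vector \<Rightarrow> 'e::complex_vector \<Rightarrow> complex) \<Rightarrow> ('e \<Rightarrow> 'f) \<Rightarrow> ('e \<Rightarrow> 'f) \<Rightarrow> bool"
  where "singular_op pr A B \<longleftrightarrow>
    (\<forall>C \<in> weak_operators pr.
      positive_op pr C \<and> op_le pr C A \<and> op_le pr C B \<longrightarrow> C = (\<lambda>x. 0))"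

section \<open>Complex Hilbert spaces\<close>

text \<open>
  The Hilbert space attached to a positive operator depends on the operator, so Hilbert spaces are
  taken to be linear subspaces \<open>H\<close> of an ambient type; the values of \<open>ip\<close> off \<open>H\<close> are irrelevant.
  The inner product is linear in the first variable.
\<close>

definition hnorm :: "('h \<Rightarrow> 'h \<Rightarrow> complex) \<Rightarrow> 'h \<Rightarrow> real"
  where "hnorm ip h = sqrt (Re (ip h h))"

text \<open>The conditional makes \<open>hdist\<close> nonnegative and symmetric on the whole type, as the locale
  \<^locale>\<open>Metric_space\<close> demands.\<close>

definition hdist :: "'h::complex_vector set \<Rightarrow> ('h \<Rightarrow> 'h \<Rightarrow> complex) \<Rightarrow> 'h \<Rightarrow> 'h \<Rightarrow> real"
  where "hdist H ip h k = (if h \<in> H \<and> k \<in> H then hnorm ip (h - k) else 0)"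

definition htopology :: "'h::complex_vector set \<Rightarrow> ('h \<Rightarrow> 'h \<Rightarrow> complex) \<Rightarrow> 'h topology"
  where "htopology H ip = Metric_space.mtopology H (hdist H ip)"

definition hweak :: "'h::complex_vector set \<Rightarrow> ('h \<Rightarrow> 'h \<Rightarrow> complex) \<Rightarrow> 'h topology"
  where "hweak H ip = weak_topology_on H ((\<lambda>k h. ip h k) ` H)"

locale complex_semi_inner_space =
  fixes H :: "'h::complex_vector set" and ip :: "'h \<Rightarrow> 'h \<Rightarrow> complex"
  assumes subspace_H: "complex_vector.subspace H"
    and ip_add_left: "\<lbrakk>h \<in> H; k \<in> H; l \<in> H\<rbrakk> \<Longrightarrow> ip (h + k) l = ip h l + ip k l"
    and ip_scale_left: "\<lbrakk>h \<in> H; k \<in> H\<rbrakk> \<Longrightarrow> ip (c *\<^sub>C h) k = c * ip h k"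
    and ip_commute: "\<lbrakk>h \<in> H; k \<in> H\<rbrakk> \<Longrightarrow> ip h k = cnj (ip k h)"
    and ip_self: "h \<in> H \<Longrightarrow> ip h h \<in> \<real>\<^sub>\<ge>\<^sub>0"
begin

lemma H_closed:
  "0 \<in> H" "\<lbrakk>h \<in> H; k \<in> H\<rbrakk> \<Longrightarrow> h + k \<in> H" "\<lbrakk>h \<in> H; k \<in> H\<rbrakk> \<Longrightarrow> h - k \<in> H"
  "h \<in> H \<Longrightarrow> c *\<^sub>C h \<in> H" "h \<in> H \<Longrightarrow> - h \<in> H"
  using subspace_H
  by (auto intro: complex_vector.subspace_0 complex_vector.subspace_add
      complex_vector.subspace_diff complex_vector.subspace_scale complex_vector.subspace_neg)

lemma ip_add_right: "\<lbrakk>h \<in> H; k \<in> H; l \<in> H\<rbrakk> \<Longrightarrow> ip l (h + k) = ip l h + ip l k"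
  by (metis H_closed(2) complex_cnj_add ip_add_left ip_commute)

lemma ip_scale_right: "\<lbrakk>h \<in> H; k \<in> H\<rbrakk> \<Longrightarrow> ip h (c *\<^sub>C k) = cnj c * ip h k"
  by (metis H_closed(4) complex_cnj_mult ip_scale_left ip_commute)

lemma ip_diff_left: "\<lbrakk>h \<in> H; k \<in> H; l \<in> H\<rbrakk> \<Longrightarrow> ip (h - k) l = ip h l - ip k l"
  by (metis H_closed(3) add_diff_cancel_right' diff_add_cancel ip_add_left)

lemma ip_diff_right: "\<lbrakk>h \<in> H; k \<in> H; l \<in> H\<rbrakk> \<Longrightarrow> ip l (h - k) = ip l h - ip l k"
  by (metis H_closed(3) add_diff_cancel_right' diff_add_cancel ip_add_right)

lemma ip_self_complex: "h \<in> H \<Longrightarrow> ip h h = complex_of_real ((hnorm ip h)\<^sup>2)"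
  using ip_self[of h] by (auto simp: hnorm_def nonneg_Reals_def simp flip: of_real_power)

lemma Re_ip_self: "h \<in> H \<Longrightarrow> Re (ip h h) = (hnorm ip h)\<^sup>2"
  by (simp add: ip_self_complex)

lemma hnorm_nonneg: "h \<in> H \<Longrightarrow> 0 \<le> hnorm ip h"
  using ip_self[of h] by (auto simp: hnorm_def nonneg_Reals_def)

lemma Cauchy_Schwarz:
  assumes [simp]: "h \<in> H" "k \<in> H"
  shows "cmod (ip h k) \<le> hnorm ip h * hnorm ip k"
proof -
  define a b c where "a = (hnorm ip h)\<^sup>2" "b = ip h k" "c = (hnorm ip k)\<^sup>2"
  have key: "0 \<le> a - 2 * s * (cmod b)\<^sup>2 + s\<^sup>2 * (cmod b)\<^sup>2 * c" for s :: real
  proof -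
    define t where "t = complex_of_real s * b"
    have "ip (h - t *\<^sub>C k) (h - t *\<^sub>C k) = ip h h - cnj t * b - t * cnj b + t * cnj t * ip k k"
      by (simp add: ip_diff_left ip_diff_right ip_scale_left ip_scale_right H_closed
          a_b_c_def ip_commute[of k h] algebra_simps)
    also have "\<dots> = complex_of_real (a - 2 * s * (cmod b)\<^sup>2 + s\<^sup>2 * (cmod b)\<^sup>2 * c)"
      by (simp add: ip_self_complex t_def a_b_c_def complex_norm_square del: of_real_power)
        (simp add: algebra_simps power2_eq_square)
    finally have "hnorm ip (h - t *\<^sub>C k) ^ 2 = a - 2 * s * (cmod b)\<^sup>2 + s\<^sup>2 * (cmod b)\<^sup>2 * c"
      by (metis H_closed(3,4) Re_complex_of_real Re_ip_self assms)
    then show ?thesis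
      by (metis zero_le_power2)
  qed
  have "(cmod b)\<^sup>2 \<le> a * c"
  proof (cases "c = 0")
    case True
    have "cmod b = 0"
    proof (rule ccontr)
      assume "cmod b \<noteq> 0"
      then show False
        using key[of "(a + 1) / (2 * (cmod b)\<^sup>2)"] True by (simp add: a_b_c_def)
    qed
    then show ?thesis using True by simp
  next
    case False
    then have "c > 0" by (simp add: a_b_c_def)
    then show ?thesis
      using key[of "1 / c"] by (simp add: field_simps power2_eq_square)
  qed
  then have "(cmod b)\<^sup>2 \<le> (hnorm ip h * hnorm ip k)\<^sup>2"
    by (simp add: a_b_c_def power_mult_distrib)
  then show ?thesis
    unfolding a_b_c_def by (rule power2_le_imp_le) (simp add: hnorm_nonneg)
qed

lemma hnorm_triangle:
  assumes [simp]: "h \<in> H" "k \<in> H"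
  shows "hnorm ip (h + k) \<le> hnorm ip h + hnorm ip k"
proof (rule power2_le_imp_le)
  have "(hnorm ip (h + k))\<^sup>2 = Re (ip (h + k) (h + k))"
    by (simp add: Re_ip_self H_closed)
  also have "\<dots> = (hnorm ip h)\<^sup>2 + (hnorm ip k)\<^sup>2 + 2 * Re (ip h k)"
    by (simp add: ip_add_left ip_add_right H_closed Re_ip_self ip_commute[of k h])
  also have "\<dots> \<le> (hnorm ip h + hnorm ip k)\<^sup>2"
    using Cauchy_Schwarz[of h k] complex_Re_le_cmod[of "ip h k"]
    by (simp add: power2_sum)
  finally show "(hnorm ip (h + k))\<^sup>2 \<le> (hnorm ip h + hnorm ip k)\<^sup>2" .
qed (simp add: hnorm_nonneg)

lemma hnorm_minus: "h \<in> H \<Longrightarrow> hnorm ip (- h) = hnorm ip h"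
proof -
  assume [simp]: "h \<in> H"
  have "- h = (-1) *\<^sub>C h" by simp
  then have "ip (- h) (- h) = ip h h"
    by (metis H_closed(5) \<open>h \<in> H\<close> complex_cnj_minus complex_cnj_one ip_scale_left ip_scale_right
        mult_minus1 minus_minus)
  then show ?thesis by (simp add: hnorm_def)
qed

lemma hnorm_diff_commute: "\<lbrakk>h \<in> H; k \<in> H\<rbrakk> \<Longrightarrow> hnorm ip (h - k) = hnorm ip (k - h)"
  by (metis H_closed(3) hnorm_minus minus_diff_eq)

lemma hnorm_diff_triangle:
  "\<lbrakk>h \<in> H; k \<in> H; l \<in> H\<rbrakk> \<Longrightarrow> hnorm ip (h - l) \<le> hnorm ip (h - k) + hnorm ip (k - l)"
  using hnorm_triangle[of "h - k" "k - l"] by (simp add: H_closed)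

end

locale complex_inner_space = complex_semi_inner_space +
  assumes ip_definite: "\<lbrakk>h \<in> H; ip h h = 0\<rbrakk> \<Longrightarrow> h = 0"
begin

lemma Metric_space_hdist: "Metric_space H (hdist H ip)"
proof
  fix h k l
  show "0 \<le> hdist H ip h k"
    by (simp add: hdist_def hnorm_nonneg H_closed)
  show "hdist H ip h k = hdist H ip k h"
    by (simp add: hdist_def hnorm_diff_commute)
  show "hdist H ip h k = 0 \<longleftrightarrow> h = k" if "h \<in> H" "k \<in> H"
  proof
    assume "hdist H ip h k = 0"
    then have "ip (h - k) (h - k) = 0"
      using that by (simp add: hdist_def ip_self_complex H_closed)
    then show "h = k"
      using ip_definite[of "h - k"] that by (simp add: H_closed)
  next
    assume "h = k"
    then show "hdist H ip h k = 0"
      using ip_scale_left[of 0 0 0] by (simp add: hdist_def hnorm_def H_closed)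
  qed
  show "hdist H ip h l \<le> hdist H ip h k + hdist H ip k l" if "h \<in> H" "k \<in> H" "l \<in> H"
    using that by (simp add: hdist_def hnorm_diff_triangle)
qed

end

locale complex_hilbert_space = complex_inner_space +
  assumes complete: "Metric_space.mcomplete H (hdist H ip)"

definition orth_proj ::
  "('h::complex_vector \<Rightarrow> 'h \<Rightarrow> complex) \<Rightarrow> 'h set \<Rightarrow> 'h \<Rightarrow> 'h"
  where "orth_proj ip M h = (THE p. p \<in> M \<and> (\<forall>m \<in> M. ip (h - p) m = 0))"

section \<open>The auxiliary Hilbert space of a positive operator\<close>

text \<open>
  \<open>(H, ip)\<close> together with the embedding \<open>\<iota>\<close> of the range of \<open>A\<close> is a Hilbert completion of that range
  under the inner product $(Ax \mid Ay)_A = \langle Ax, y\rangle$. Only the values of \<open>\<iota>\<close> on the range of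
  \<open>A\<close> matter.
\<close>

locale hilbert_completion = complex_hilbert_space H ip
  for pr :: "'f::complex_vector \<Rightarrow> 'e::complex_vector \<Rightarrow> complex"
    and A :: "'e \<Rightarrow> 'f"
    and H :: "'h::complex_vector set" and ip :: "'h \<Rightarrow> 'h \<Rightarrow> complex"
    and \<iota> :: "'f \<Rightarrow> 'h" +
  assumes iota_in: "\<iota> (A x) \<in> H"
    and iota_add: "\<lbrakk>f \<in> range A; g \<in> range A\<rbrakk> \<Longrightarrow> \<iota> (f + g) = \<iota> f + \<iota> g"
    and iota_scale: "f \<in> range A \<Longrightarrow> \<iota> (c *\<^sub>C f) = c *\<^sub>C \<iota> f"
    and iota_isometric: "ip (\<iota> (A x)) (\<iota> (A y)) = pr (A x) y"
    and iota_dense: "htopology H ip closure_of (\<iota> ` range A) = H"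

text \<open>$J_A$, the weakly continuous linear extension to $\mathcal H_A$ of the inclusion of the range
  of \<open>A\<close> into $F$; its value is irrelevant (and fixed to \<^const>\<open>undefined\<close>) off \<open>H\<close>.\<close>

definition J_op ::
  "('f::complex_vector \<Rightarrow> 'e::complex_vector \<Rightarrow> complex) \<Rightarrow> ('e \<Rightarrow> 'f) \<Rightarrow>
    'h::complex_vector set \<Rightarrow> ('h \<Rightarrow> 'h \<Rightarrow> complex) \<Rightarrow> ('f \<Rightarrow> 'h) \<Rightarrow> 'h \<Rightarrow> 'f"
  where "J_op pr A H ip \<iota> = (THE J. J \<in> extensional H \<and>
    (\<forall>h\<in>H. \<forall>k\<in>H. J (h + k) = J h + J k) \<and>
    (\<forall>c. \<forall>h\<in>H. J (c *\<^sub>C h) = c *\<^sub>C J h) \<and>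
    continuous_map (hweak H ip) (sigmaF pr) J \<and>
    (\<forall>f \<in> range A. J (\<iota> f) = f))"

text \<open>The adjoint $J^* : E \to \mathcal H$ of an operator $J : \mathcal H \to F$.\<close>

definition adjoint_op ::
  "('f::complex_vector \<Rightarrow> 'e::complex_vector \<Rightarrow> complex) \<Rightarrow>
    'h::complex_vector set \<Rightarrow> ('h \<Rightarrow> 'h \<Rightarrow> complex) \<Rightarrow> ('h \<Rightarrow> 'f) \<Rightarrow> 'e \<Rightarrow> 'h"
  where "adjoint_op pr H ip J x = (THE g. g \<in> H \<and> (\<forall>h\<in>H. pr (J h) x = ip h g))"

definition M_space ::
  "('e::complex_vector \<Rightarrow> 'f::complex_vector) \<Rightarrow>
    'a::complex_vector set \<Rightarrow> ('a \<Rightarrow> 'a \<Rightarrow> complex) \<Rightarrow> ('f \<Rightarrow> 'a) \<Rightarrow> ('e \<Rightarrow> 'f) \<Rightarrow>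
    'b::complex_vector set \<Rightarrow> ('b \<Rightarrow> 'b \<Rightarrow> complex) \<Rightarrow> ('f \<Rightarrow> 'b) \<Rightarrow> 'b set"
  where "M_space A HA ipA \<iota>A B HB ipB \<iota>B =
    {\<xi> \<in> HB. (0, \<xi>) \<in> prod_topology (htopology HA ipA) (htopology HB ipB)
      closure_of range (\<lambda>x. (\<iota>A (A x), \<iota>B (B x)))}"

section \<open>Existence of the completion\<close>

text \<open>
  The hypothesis \<^locale>\<open>hilbert_completion\<close> can be met for every positive operator: a Cauchy sequence
  $(x_n)$ for the semi-inner product $\langle Ax, y\rangle$ is represented by the functional
  $y \mapsto \lim_n \langle Ax_n, y\rangle$.
\<close>

instantiation complex :: complex_vector
begin
definition scaleC_complex :: "complex \<Rightarrow> complex \<Rightarrow> complex" where "scaleC_complex = (*)"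
instance by standard (simp_all add: scaleC_complex_def algebra_simps)
end

instantiation "fun" :: (type, complex_vector) complex_vector
begin
definition scaleC_fun :: "complex \<Rightarrow> ('a \<Rightarrow> 'b) \<Rightarrow> 'a \<Rightarrow> 'b"
  where "scaleC_fun c f = (\<lambda>x. c *\<^sub>C f x)"
instance
  by standard (simp_all add: scaleC_fun_def fun_eq_iff scaleC_add_right scaleC_add_left
      scaleC_scaleC scaleC_one)
end

locale semi_inner_completion = complex_semi_inner_space UNIV ip
  for ip :: "'e::complex_vector \<Rightarrow> 'e \<Rightarrow> complex"
begin

abbreviation "nm \<equiv> hnorm ip"

definition cau :: "(nat \<Rightarrow> 'e) \<Rightarrow> bool"
  where "cau x \<longleftrightarrow> (\<forall>e>0. \<exists>N. \<forall>m\<ge>N. \<forall>n\<ge>N. nm (x m - x n) < e)"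

definition rep :: "(nat \<Rightarrow> 'e) \<Rightarrow> ('e \<Rightarrow> complex) \<Rightarrow> bool"
  where "rep x \<phi> \<longleftrightarrow> cau x \<and> (\<forall>y. (\<lambda>n. ip (x n) y) \<longlonglongrightarrow> \<phi> y)"

definition HC :: "('e \<Rightarrow> complex) set" where "HC = {\<phi>. \<exists>x. rep x \<phi>}"

definition IP :: "('e \<Rightarrow> complex) \<Rightarrow> ('e \<Rightarrow> complex) \<Rightarrow> complex"
  where "IP \<phi> \<psi> = lim (\<lambda>n. ip ((SOME x. rep x \<phi>) n) ((SOME x. rep x \<psi>) n))"

lemma nm_ge0 [simp]: "0 \<le> nm x" by (rule hnorm_nonneg) simp

lemma nm_tri: "nm (x + y) \<le> nm x + nm y" by (rule hnorm_triangle) auto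

lemma CS: "cmod (ip x y) \<le> nm x * nm y" by (rule Cauchy_Schwarz) auto

lemma nm_tri3: "nm (x - z) \<le> nm (x - y) + nm (y - z)" by (rule hnorm_diff_triangle) auto

lemma nm_comm: "nm (x - y) = nm (y - x)" by (rule hnorm_diff_commute) auto

lemmas ip_simps = ip_add_left[OF UNIV_I UNIV_I UNIV_I] ip_add_right[OF UNIV_I UNIV_I UNIV_I]
  ip_diff_left[OF UNIV_I UNIV_I UNIV_I] ip_diff_right[OF UNIV_I UNIV_I UNIV_I]
  ip_scale_left[OF UNIV_I UNIV_I] ip_scale_right[OF UNIV_I UNIV_I]

lemma nm_scale: "nm (c *\<^sub>C x) = cmod c * nm x"
proof -
  have "ip (c *\<^sub>C x) (c *\<^sub>C x) = complex_of_real ((cmod c * nm x)\<^sup>2)"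
    by (simp add: ip_simps ip_self_complex power_mult_distrib complex_norm_square
        del: of_real_power)
  then have "(nm (c *\<^sub>C x))\<^sup>2 = (cmod c * nm x)\<^sup>2"
    by (metis Re_complex_of_real Re_ip_self UNIV_I)
  then show ?thesis by simp
qed

lemma cau_bounded: assumes "cau x" obtains K where "K > 0" "\<And>n. nm (x n) \<le> K"
proof -
  obtain N where N: "\<And>m n. m \<ge> N \<Longrightarrow> n \<ge> N \<Longrightarrow> nm (x m - x n) < 1"
    using assms unfolding cau_def by (meson zero_less_one)
  have "nm (x n) \<le> 1 + nm (x N) + (\<Sum>k<N. nm (x k))" for n
  proof (cases "n < N")
    case True
    then have "nm (x n) \<le> (\<Sum>k<N. nm (x k))" by (intro member_le_sum) auto
    then show ?thesis by (smt (verit) nm_ge0)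
  next
    case False
    have "nm (x n) \<le> nm (x n - x N) + nm (x N)" using nm_tri[of "x n - x N" "x N"] by simp
    also have "\<dots> \<le> 1 + nm (x N)" using N[of n N] False by simp
    finally show ?thesis by (smt (verit) nm_ge0 sum_nonneg)
  qed
  then show ?thesis
    by (intro that[of "1 + nm (x N) + (\<Sum>k<N. nm (x k))"]) (auto simp: add_pos_nonneg sum_nonneg)
qed

lemma cau_convergent:
  assumes "cau x" "cau y" shows "convergent (\<lambda>n. ip (x n) (y n))"
proof -
  obtain K where K: "K > 0" "\<And>n. nm (x n) \<le> K" using cau_bounded[OF assms(1)] by auto
  obtain L where L: "L > 0" "\<And>n. nm (y n) \<le> L" using cau_bounded[OF assms(2)] by auto
  have "Cauchy (\<lambda>n. ip (x n) (y n))"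
  proof (rule CauchyI)
    fix e :: real assume "e > 0"
    then obtain N1 where N1: "\<And>m n. m \<ge> N1 \<Longrightarrow> n \<ge> N1 \<Longrightarrow> nm (x m - x n) < e / (2 * L)"
      using assms(1) L unfolding cau_def
      by (metis divide_pos_pos mult_pos_pos zero_less_numeral)
    obtain N2 where N2: "\<And>m n. m \<ge> N2 \<Longrightarrow> n \<ge> N2 \<Longrightarrow> nm (y m - y n) < e / (2 * K)"
      using assms(2) K \<open>e > 0\<close> unfolding cau_def
      by (metis divide_pos_pos mult_pos_pos zero_less_numeral)
    show "\<exists>M. \<forall>m\<ge>M. \<forall>n\<ge>M. cmod (ip (x m) (y m) - ip (x n) (y n)) < e"
    proof (intro exI allI impI)
      fix m n assume mn: "m \<ge> max N1 N2" "n \<ge> max N1 N2"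
      have "ip (x m) (y m) - ip (x n) (y n) = ip (x m - x n) (y m) + ip (x n) (y m - y n)"
        by (simp add: ip_simps)
      then have "cmod (ip (x m) (y m) - ip (x n) (y n))
          \<le> nm (x m - x n) * nm (y m) + nm (x n) * nm (y m - y n)"
        by (smt (verit) CS norm_triangle_ineq)
      also have "nm (x m - x n) * nm (y m) \<le> nm (x m - x n) * L"
        by (intro mult_left_mono L) simp
      also have "nm (x m - x n) * L < e / 2"
        using N1[of m n] mn L by (simp add: field_simps)
      also have "nm (x n) * nm (y m - y n) \<le> K * nm (y m - y n)"
        by (intro mult_right_mono K) simp
      also have "K * nm (y m - y n) < e / 2"
        using N2[of m n] mn K by (simp add: field_simps)
      finally show "cmod (ip (x m) (y m) - ip (x n) (y n)) < e" by simp
    qed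
  qed
  then show ?thesis by (rule Cauchy_convergent)
qed

lemma cau_null:
  assumes "cau z" "\<And>y. (\<lambda>n. ip (z n) y) \<longlonglongrightarrow> 0"
  shows "(\<lambda>n. nm (z n)) \<longlonglongrightarrow> 0"
proof (rule LIMSEQ_I)
  fix e :: real assume "e > 0"
  obtain K where K: "K > 0" "\<And>n. nm (z n) \<le> K" using cau_bounded[OF assms(1)] by auto
  have e2: "e\<^sup>2 / (2 * K) > 0" using K \<open>e > 0\<close> by simp
  then obtain N where N: "\<And>m n. m \<ge> N \<Longrightarrow> n \<ge> N \<Longrightarrow> nm (z m - z n) < e\<^sup>2 / (2 * K)"
    using assms(1) unfolding cau_def by meson
  have "e\<^sup>2 / 2 > 0" using \<open>e > 0\<close> by simp
  then obtain N' where N': "\<And>n. n \<ge> N' \<Longrightarrow> cmod (ip (z n) (z N)) < e\<^sup>2 / 2"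
    using LIMSEQ_D[OF assms(2)[of "z N"]] by (metis diff_zero)
  show "\<exists>no. \<forall>n\<ge>no. norm (nm (z n) - 0) < e"
  proof (intro exI allI impI)
    fix n assume n: "n \<ge> max N N'"
    have "(nm (z n))\<^sup>2 = cmod (ip (z n) (z N) + ip (z n) (z n - z N))"
      by (simp add: ip_simps ip_self_complex norm_power)
    also have "\<dots> \<le> cmod (ip (z n) (z N)) + nm (z n) * nm (z n - z N)"
      by (smt (verit) CS norm_triangle_ineq)
    also have "nm (z n) * nm (z n - z N) \<le> K * nm (z n - z N)"
      by (intro mult_right_mono K) simp
    also have "K * nm (z n - z N) < e\<^sup>2 / 2"
      using N[of n N] n K by (simp add: field_simps)
    finally have "(nm (z n))\<^sup>2 < e\<^sup>2" using N'[of n] n by simp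
    then show "norm (nm (z n) - 0) < e"
      using \<open>e > 0\<close> by (simp add: power2_less_imp_less)
  qed
qed

lemma cau_lin: assumes "cau x" "cau y" shows "cau (\<lambda>n. x n + c *\<^sub>C y n)"
  unfolding cau_def
proof (intro allI impI)
  fix e :: real assume "e > 0"
  obtain N1 where N1: "\<And>m n. m \<ge> N1 \<Longrightarrow> n \<ge> N1 \<Longrightarrow> nm (x m - x n) < e / 2"
    using assms(1) \<open>e > 0\<close> unfolding cau_def by (metis half_gt_zero)
  have "e / (2 * (cmod c + 1)) > 0" using \<open>e > 0\<close> by (simp add: add_nonneg_pos)
  then obtain N2 where N2: "\<And>m n. m \<ge> N2 \<Longrightarrow> n \<ge> N2 \<Longrightarrow> nm (y m - y n) < e / (2 * (cmod c + 1))"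
    using assms(2) unfolding cau_def by metis
  have "nm ((x m + c *\<^sub>C y m) - (x n + c *\<^sub>C y n)) < e" if "m \<ge> max N1 N2" "n \<ge> max N1 N2" for m n
  proof -
    have "(x m + c *\<^sub>C y m) - (x n + c *\<^sub>C y n) = (x m - x n) + c *\<^sub>C (y m - y n)"
      by (simp add: complex_vector.scale_right_diff_distrib)
    then have "nm ((x m + c *\<^sub>C y m) - (x n + c *\<^sub>C y n)) \<le> nm (x m - x n) + cmod c * nm (y m - y n)"
      using nm_tri[of "x m - x n" "c *\<^sub>C (y m - y n)"] by (simp only: nm_scale)
    also have "cmod c * nm (y m - y n) \<le> (cmod c + 1) * nm (y m - y n)"
      by (intro mult_right_mono) auto
    also have "(cmod c + 1) * nm (y m - y n) < e / 2"
      using N2[of m n] that by (simp add: field_simps add_pos_nonneg)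
    finally show ?thesis using N1[of m n] that by simp
  qed
  then show "\<exists>N. \<forall>m\<ge>N. \<forall>n\<ge>N. nm ((x m + c *\<^sub>C y m) - (x n + c *\<^sub>C y n)) < e" by blast
qed

lemma rep_lin: "rep x \<phi> \<Longrightarrow> rep y \<psi> \<Longrightarrow> rep (\<lambda>n. x n + c *\<^sub>C y n) (\<phi> + c *\<^sub>C \<psi>)"
  unfolding rep_def
  by (auto simp: cau_lin ip_simps scaleC_fun_def scaleC_complex_def intro!: tendsto_intros)

lemma ip_0: "ip 0 = 0"
  using ip_scale_left[of 0 _ 0] by (simp add: fun_eq_iff)

lemma rep_const: "rep (\<lambda>_. x) (ip x)"
proof -
  show ?thesis by (simp add: rep_def cau_def hnorm_def ip_0)
qed

lemma ip_null:
  assumes "cau x" "(\<lambda>n. nm (z n)) \<longlonglongrightarrow> 0" shows "(\<lambda>n. ip (x n) (z n)) \<longlonglongrightarrow> 0"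
proof -
  obtain K where K: "K > 0" "\<And>n. nm (x n) \<le> K" using cau_bounded[OF assms(1)] by auto
  have "\<forall>\<^sub>F n in sequentially. norm (ip (x n) (z n)) \<le> nm (z n) * K"
    by (intro always_eventually allI)
      (metis CS K(2) mult.commute mult_right_mono nm_ge0 order_trans)
  moreover have "(\<lambda>n. nm (z n) * K) \<longlonglongrightarrow> 0" using tendsto_mult_right[OF assms(2), of K] by simp
  ultimately show ?thesis by (rule Lim_null_comparison)
qed

lemma rep_diff_null:
  assumes "rep x \<phi>" "rep x' \<phi>" shows "(\<lambda>n. nm (x n - x' n)) \<longlonglongrightarrow> 0"
proof (rule cau_null)
  have "rep (\<lambda>n. x n + (-1) *\<^sub>C x' n) (\<phi> + (-1) *\<^sub>C \<phi>)" by (rule rep_lin[OF assms])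
  then have r: "rep (\<lambda>n. x n - x' n) 0" by simp
  then show "cau (\<lambda>n. x n - x' n)" by (simp add: rep_def)
  show "(\<lambda>n. ip (x n - x' n) y) \<longlonglongrightarrow> 0" for y using r by (simp add: rep_def)
qed

lemma IP_lim:
  assumes "rep x \<phi>" "rep y \<psi>" shows "(\<lambda>n. ip (x n) (y n)) \<longlonglongrightarrow> IP \<phi> \<psi>"
proof -
  define x' y' where "x' = (SOME x. rep x \<phi>)" "y' = (SOME x. rep x \<psi>)"
  have r: "rep x' \<phi>" "rep y' \<psi>" unfolding x'_y'_def using someI[of "\<lambda>x. rep x _", OF assms(1)] someI[of "\<lambda>x. rep x _", OF assms(2)] by auto
  have c: "cau x" "cau y" "cau x'" "cau y'" using r assms by (auto simp: rep_def)
  have l: "(\<lambda>n. ip (x' n) (y' n)) \<longlonglongrightarrow> IP \<phi> \<psi>"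
    unfolding IP_def x'_y'_def[symmetric] using cau_convergent[OF c(3,4)] convergent_LIMSEQ_iff by blast
  have "(\<lambda>n. ip (x' n) (y n - y' n)) \<longlonglongrightarrow> 0"
    by (rule ip_null[OF c(3) rep_diff_null[OF assms(2) r(2)]])
  moreover have "(\<lambda>n. cnj (ip (y n) (x n - x' n))) \<longlonglongrightarrow> cnj 0"
    by (intro tendsto_cnj ip_null[OF c(2) rep_diff_null[OF assms(1) r(1)]])
  then have "(\<lambda>n. ip (x n - x' n) (y n)) \<longlonglongrightarrow> 0"
    by (simp flip: ip_commute[OF UNIV_I UNIV_I])
  ultimately have "(\<lambda>n. ip (x' n) (y' n) + ip (x' n) (y n - y' n) + ip (x n - x' n) (y n))
      \<longlonglongrightarrow> IP \<phi> \<psi> + 0 + 0"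
    by (intro tendsto_add l)
  then show ?thesis by (simp add: ip_simps)
qed

lemma IP_eqI: "rep x \<phi> \<Longrightarrow> rep y \<psi> \<Longrightarrow> (\<lambda>n. ip (x n) (y n)) \<longlonglongrightarrow> c \<Longrightarrow> IP \<phi> \<psi> = c"
  using IP_lim LIMSEQ_unique by blast

lemma subspace_HC: "complex_vector.subspace HC"
proof (rule complex_vector.subspaceI)
  have r0: "rep (\<lambda>_. 0) 0" using rep_const[of 0] by (simp add: ip_0)
  then show "0 \<in> HC" by (auto simp: HC_def)
  show "\<phi> + \<psi> \<in> HC" if "\<phi> \<in> HC" "\<psi> \<in> HC" for \<phi> \<psi>
    using that rep_lin[of _ \<phi> _ \<psi> 1] by (auto simp: HC_def scaleC_one)
  show "c *\<^sub>C \<phi> \<in> HC" if "\<phi> \<in> HC" for c \<phi>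
    using that rep_lin[OF r0, of _ \<phi> c] by (auto simp: HC_def)
qed

sublocale HC: complex_inner_space HC IP
proof
  show "complex_vector.subspace HC" by (rule subspace_HC)
  fix \<phi> \<psi> \<theta> assume "\<phi> \<in> HC"
  then obtain x where x: "rep x \<phi>" by (auto simp: HC_def)
  have 0: "rep (\<lambda>n. 0) 0" using rep_const[of 0] by (simp add: ip_0)
  show "IP \<phi> \<phi> \<in> \<real>\<^sub>\<ge>\<^sub>0"
    by (rule closed_sequentially[OF closed_nonneg_Reals_complex _ IP_lim[OF x x]])
      (auto intro: ip_self)
  {
    assume "IP \<phi> \<phi> = 0"
    then have "(\<lambda>n. Re (ip (x n) (x n))) \<longlonglongrightarrow> 0" using tendsto_Re[OF IP_lim[OF x x]] by simp
    then have "(\<lambda>n. nm (x n)) \<longlonglongrightarrow> 0"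
      unfolding hnorm_def using tendsto_real_sqrt by fastforce
    then have "(\<lambda>n. cnj (ip y (x n))) \<longlonglongrightarrow> cnj 0" for y
      using ip_null[of "\<lambda>_. y" x] rep_const[of y] by (intro tendsto_cnj) (simp add: rep_def)
    then have "(\<lambda>n. ip (x n) y) \<longlonglongrightarrow> 0" for y
      by (simp flip: ip_commute[OF UNIV_I UNIV_I])
    then have "\<phi> y = 0" for y using x LIMSEQ_unique unfolding rep_def by blast
    then show "\<phi> = 0" by (simp add: fun_eq_iff)
  }
  assume "\<psi> \<in> HC"
  then obtain y where y: "rep y \<psi>" by (auto simp: HC_def)
  show "IP \<phi> \<psi> = cnj (IP \<psi> \<phi>)"
    by (rule IP_eqI[OF x y]) (use tendsto_cnj[OF IP_lim[OF y x]] in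
        \<open>simp flip: ip_commute[OF UNIV_I UNIV_I]\<close>)
  show "IP (c *\<^sub>C \<phi>) \<psi> = c * IP \<phi> \<psi>" for c
  proof (rule IP_eqI[OF _ y])
    show "rep (\<lambda>n. c *\<^sub>C x n) (c *\<^sub>C \<phi>)" using rep_lin[OF 0 x, of c] by simp
  qed (auto simp: ip_simps intro!: tendsto_intros IP_lim x y)
  assume "\<theta> \<in> HC"
  then obtain z where z: "rep z \<theta>" by (auto simp: HC_def)
  show "IP (\<phi> + \<psi>) \<theta> = IP \<phi> \<theta> + IP \<psi> \<theta>"
  proof (rule IP_eqI[OF _ z])
    show "rep (\<lambda>n. x n + y n) (\<phi> + \<psi>)" using rep_lin[OF x y, of 1] by (simp add: scaleC_one)
  qed (auto simp: ip_simps intro!: tendsto_intros IP_lim x y z)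
qed

lemma ip_in_HC: "ip x \<in> HC" using rep_const by (auto simp: HC_def)

lemma IP_ip: "IP (ip x) (ip y) = ip x y"
  by (rule IP_eqI[OF rep_const rep_const]) simp

lemma ip_diff: "ip x - ip y = ip (x - y)" by (simp add: fun_eq_iff ip_simps)

lemma hdist_ip: "hdist HC IP (ip x) (ip y) = nm (x - y)"
  by (simp add: hdist_def ip_in_HC hnorm_def ip_diff IP_ip)

lemma hdist_rep:
  assumes "rep x \<phi>" shows "(\<lambda>n. nm (x n - y)) \<longlonglongrightarrow> hdist HC IP \<phi> (ip y)"
proof -
  have "rep (\<lambda>n. x n + (-1) *\<^sub>C y) (\<phi> + (-1) *\<^sub>C ip y)" by (rule rep_lin[OF assms rep_const])
  then have r: "rep (\<lambda>n. x n - y) (\<phi> - ip y)" by simp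
  have "\<phi> \<in> HC" using assms by (auto simp: HC_def)
  then show ?thesis
    unfolding hdist_def hnorm_def using ip_in_HC by (simp add: tendsto_real_sqrt tendsto_Re IP_lim r)
qed

lemma rep_tendsto:
  assumes "rep x \<phi>" "e > 0" obtains N where "\<And>n. n \<ge> N \<Longrightarrow> hdist HC IP \<phi> (ip (x n)) < e"
proof -
  obtain N where N: "\<And>m n. m \<ge> N \<Longrightarrow> n \<ge> N \<Longrightarrow> nm (x m - x n) < e / 2"
    using assms unfolding rep_def cau_def by (metis half_gt_zero)
  have "hdist HC IP \<phi> (ip (x n)) \<le> e / 2" if "n \<ge> N" for n
    by (rule LIMSEQ_le_const2[OF hdist_rep[OF assms(1)]]) (use N that less_imp_le in blast)
  then show ?thesis using assms(2) by (intro that[of N]) (metis field_less_half_sum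
      add_0 le_less_trans field_sum_of_halves less_add_same_cancel1 half_gt_zero)
qed

lemma dense_HC: "htopology HC IP closure_of range ip = HC"
proof -
  interpret D: Metric_space HC "hdist HC IP" by (rule HC.Metric_space_hdist)
  have "\<exists>y\<in>range ip. hdist HC IP \<phi> y < r \<and> y \<in> HC" if "\<phi> \<in> HC" "r > 0" for \<phi> r
  proof -
    from that obtain x where "rep x \<phi>" by (auto simp: HC_def)
    from rep_tendsto[OF this \<open>r > 0\<close>]
    obtain N where "\<And>n. n \<ge> N \<Longrightarrow> hdist HC IP \<phi> (ip (x n)) < r" by blast
    then show ?thesis using ip_in_HC by blast
  qed
  then show ?thesis unfolding htopology_def D.metric_closure_of by auto
qed

sublocale HC: complex_hilbert_space HC IP
proof
  interpret D: Metric_space HC "hdist HC IP" by (rule HC.Metric_space_hdist)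
  have "\<exists>\<phi>. limitin D.mtopology \<sigma> \<phi> sequentially" if \<sigma>: "D.MCauchy \<sigma>" for \<sigma>
  proof -
    have in_HC: "\<sigma> n \<in> HC" for n using \<sigma> by (auto simp: D.MCauchy_def)
    have "\<exists>x. hdist HC IP (\<sigma> n) (ip x) < 1 / Suc n" for n
    proof -
      obtain x where "rep x (\<sigma> n)" using in_HC[of n] by (auto simp: HC_def)
      from rep_tendsto[OF this, of "1 / Suc n"]
      obtain N where "\<And>m. m \<ge> N \<Longrightarrow> hdist HC IP (\<sigma> n) (ip (x m)) < 1 / Suc n" by auto
      then show ?thesis by blast
    qed
    then obtain x where x: "\<And>n. hdist HC IP (\<sigma> n) (ip (x n)) < 1 / Suc n" by metis
    have ev: "\<exists>N. \<forall>n\<ge>N. hdist HC IP (\<sigma> n) (ip (x n)) < e" if "e > 0" for e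
    proof -
      obtain N where N: "1 / real (Suc N) < e" using \<open>e > 0\<close> nat_approx_posE by blast
      have "1 / real (Suc n) \<le> 1 / real (Suc N)" if "n \<ge> N" for n
        using that by (simp add: frac_le)
      then show ?thesis using x N by (meson order_less_le_trans order_less_trans)
    qed
    have "cau x" unfolding cau_def
    proof (intro allI impI)
      fix e :: real assume "e > 0"
      then have e3: "e / 3 > 0" by simp
      obtain N1 where N1: "\<And>n. n \<ge> N1 \<Longrightarrow> hdist HC IP (\<sigma> n) (ip (x n)) < e / 3"
        using ev[OF e3] by blast
      obtain N2 where N2: "\<And>m n. m \<ge> N2 \<Longrightarrow> n \<ge> N2 \<Longrightarrow> hdist HC IP (\<sigma> m) (\<sigma> n) < e / 3"
        using \<sigma> e3 unfolding D.MCauchy_def by meson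
      have "nm (x m - x n) < e" if "m \<ge> max N1 N2" "n \<ge> max N1 N2" for m n
      proof -
        have "hdist HC IP (ip (x m)) (ip (x n)) \<le> hdist HC IP (ip (x m)) (\<sigma> m)
          + hdist HC IP (\<sigma> m) (\<sigma> n) + hdist HC IP (\<sigma> n) (ip (x n))"
          using D.triangle[of "ip (x m)" "\<sigma> m" "ip (x n)"] D.triangle[of "\<sigma> m" "\<sigma> n" "ip (x n)"]
          by (simp add: in_HC ip_in_HC)
        also have "\<dots> < e"
          using N1[of m] N1[of n] N2[of m n] that D.commute[of "\<sigma> m" "ip (x m)"] by simp
        finally show ?thesis by (simp add: hdist_ip)
      qed
      then show "\<exists>N. \<forall>m\<ge>N. \<forall>n\<ge>N. nm (x m - x n) < e" by blast
    qed
    moreover have "convergent (\<lambda>n. ip (x n) y)" for y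
      using cau_convergent[OF \<open>cau x\<close>, of "\<lambda>_. y"] rep_const[of y] by (simp add: rep_def)
    ultimately have "rep x (\<lambda>y. lim (\<lambda>n. ip (x n) y))"
      unfolding rep_def using convergent_LIMSEQ_iff by blast
    then obtain \<phi> where \<phi>: "rep x \<phi>" by blast
    then have "\<phi> \<in> HC" by (auto simp: HC_def)
    have "\<exists>N. \<forall>n\<ge>N. \<sigma> n \<in> HC \<and> hdist HC IP (\<sigma> n) \<phi> < e" if "e > 0" for e
    proof -
      have e2: "e / 2 > 0" using that by simp
      obtain N1 where N1: "\<And>n. n \<ge> N1 \<Longrightarrow> hdist HC IP (\<sigma> n) (ip (x n)) < e / 2"
        using ev[OF e2] by blast
      obtain N2 where N2: "\<And>n. n \<ge> N2 \<Longrightarrow> hdist HC IP \<phi> (ip (x n)) < e / 2"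
        using rep_tendsto[OF \<phi> e2] by blast
      have "hdist HC IP (\<sigma> n) \<phi> < e" if "n \<ge> max N1 N2" for n
        using D.triangle'[of "\<sigma> n" "ip (x n)" \<phi>] N1[of n] N2[of n] that
        by (simp add: in_HC ip_in_HC \<open>\<phi> \<in> HC\<close>)
      then show ?thesis using in_HC by blast
    qed
    then show ?thesis
      unfolding D.limitin_metric eventually_sequentially using \<open>\<phi> \<in> HC\<close> by blast
  qed
  then show "D.mcomplete" by (simp add: D.mcomplete_def)
qed

end

lemma hilbert_completion_exists:
  fixes pr :: "'f::complex_vector \<Rightarrow> 'e::complex_vector \<Rightarrow> complex"
  assumes pair: "antidual_pair pr" and pos: "positive_op pr A"
  shows "\<exists>(H :: ('e \<Rightarrow> complex) set) ip. hilbert_completion pr A H ip pr"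
proof -
  have add: "A (x + y) = A x + A y" and scale: "A (c *\<^sub>C x) = c *\<^sub>C A x" for c x y
    using pos by (simp_all add: positive_op_def Vector_Spaces.linear_iff)
  have pr: "pr (f + g) x = pr f x + pr g x" "pr (c *\<^sub>C f) x = c * pr f x"
    "pr f (x + y) = pr f x + pr f y" "pr f (c *\<^sub>C x) = cnj c * pr f x" for f g c x y
    using pair by (simp_all add: antidual_pair_def)
  define q where "q x y = pr (A x) y" for x y
  have q: "q (x + y) z = q x z + q y z" "q (c *\<^sub>C x) z = c * q x z"
    "q x (y + z) = q x y + q x z" "q x (c *\<^sub>C y) = cnj c * q x y" for c x y z
    by (simp_all add: q_def add scale pr)
  have q_self: "q x x \<in> \<real>\<^sub>\<ge>\<^sub>0" for x using pos by (simp add: positive_op_def q_def)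
  then have im: "Im (q x x) = 0" for x by (metis complex_is_Real_iff nonneg_Reals_Real)
  have comm: "q x y = cnj (q y x)" for x y
    using im[of "x + y"] im[of "x + \<i> *\<^sub>C y"] im[of x] im[of y]
    by (auto simp: q complex_eq_iff)
  interpret semi_inner_completion q
    by unfold_locales (simp_all add: q q_self comm[symmetric])
  have q_eq: "q x = pr (A x)" for x by (simp add: q_def fun_eq_iff)
  have "hilbert_completion pr A HC IP pr"
  proof
    show "pr (A x) \<in> HC" for x using ip_in_HC[of x] by (simp add: q_eq)
    show "IP (pr (A x)) (pr (A y)) = pr (A x) y" for x y using IP_ip[of x y] by (simp add: q_eq)
    have "pr ` range A = range q" by (auto simp: q_eq)
    then show "htopology HC IP closure_of pr ` range A = HC" using dense_HC by simp
  qed (simp_all add: fun_eq_iff pr scaleC_fun_def scaleC_complex_def)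
  then show ?thesis by blast
qed

end

theory Submission
  imports Defs
begin

text \<open>
  Write \<open>u x\<close> and \<open>v x\<close> for the images of \<open>A x\<close> and \<open>B x\<close> in the two auxiliary Hilbert spaces, and
  \<open>Q = I - P\<close>. The operators \<open>B\<^sub>a\<close> and \<open>B\<^sub>s\<close> have the quadratic forms $\|Qv x\|^2$ and $\|Pv x\|^2$, and
  every \<open>\<xi> \<in> M\<close> is a limit of \<open>v y\<^sub>n\<close> with \<open>u y\<^sub>n \<rightarrow> 0\<close>. Choose such \<open>y\<^sub>n\<close> for \<open>\<xi> = P v x\<close>. If \<open>C \<le> A\<close> and
  \<open>C \<le> B\<^sub>s\<close>, then the \<open>C\<close>-seminorms of \<open>y\<^sub>n\<close> and of \<open>x - y\<^sub>n\<close> both tend to 0, so \<open>C = 0\<close>. If \<open>D \<le> B\<close> is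
  \<open>A\<close>-absolutely continuous, then \<open>y\<^sub>n\<close> is \<open>D\<close>-Cauchy, so its \<open>D\<close>-seminorm tends to 0 and the
  \<open>D\<close>-seminorm of \<open>x\<close> is at most $\lim \|v (x - y_n)\| = \|Qv x\|$.
\<close>

section \<open>Weak topologies\<close>

text \<open>Taking \<open>U = UNIV\<close> puts \<open>S\<close> itself into the subbasis.
  Nonemptiness matters: without generators the generated topology would have empty carrier.\<close>

lemma topspace_weak_topology_on:
  assumes "\<Phi> \<noteq> {}" shows "topspace (weak_topology_on S \<Phi>) = S"
proof -
  obtain \<phi> where "\<phi> \<in> \<Phi>" using assms by blast
  then have "S \<in> {{s \<in> S. \<phi> s \<in> U} |\<phi> U. \<phi> \<in> \<Phi> \<and> open U}"
    by (intro CollectI exI[of _ \<phi>] exI[of _ UNIV]) auto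
  then show ?thesis
    unfolding weak_topology_on_def topology_generated_by_topspace by auto
qed

lemma continuous_map_weak_topology_on:
  assumes "\<phi> \<in> \<Phi>" shows "continuous_map (weak_topology_on S \<Phi>) euclidean \<phi>"
proof -
  have "openin (weak_topology_on S \<Phi>) {s \<in> S. \<phi> s \<in> U}" if "open U" for U
    unfolding weak_topology_on_def using that assms
    by (intro topology_generated_by_Basis) auto
  moreover have "topspace (weak_topology_on S \<Phi>) = S"
    using assms by (intro topspace_weak_topology_on) blast
  ultimately show ?thesis by (simp add: continuous_map_def)
qed

lemma continuous_map_into_weak_topology_on:
  assumes "\<Phi> \<noteq> {}" "g \<in> topspace X \<rightarrow> S"
    and "\<And>\<phi>. \<phi> \<in> \<Phi> \<Longrightarrow> continuous_map X euclidean (\<lambda>x. \<phi> (g x))"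
  shows "continuous_map X (weak_topology_on S \<Phi>) g"
  unfolding weak_topology_on_def
proof (rule continuous_on_generated_topo)
  fix V assume "V \<in> {{s \<in> S. \<phi> s \<in> U} |\<phi> U. \<phi> \<in> \<Phi> \<and> open U}"
  then obtain \<phi> U where V: "V = {s \<in> S. \<phi> s \<in> U}" "\<phi> \<in> \<Phi>" "open U" by blast
  have "g -` V \<inter> topspace X = {x \<in> topspace X. \<phi> (g x) \<in> U}"
    using assms(2) V(1) by auto
  then show "openin X (g -` V \<inter> topspace X)"
    using assms(3)[OF V(2)] V(3) by (simp add: continuous_map_def)
next
  have "\<Union> {{s \<in> S. \<phi> s \<in> U} |\<phi> U. \<phi> \<in> \<Phi> \<and> open U} = S"
    using topspace_weak_topology_on[OF assms(1), of S]
    by (simp add: weak_topology_on_def topology_generated_by_topspace)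
  then show "g ` topspace X \<subseteq> \<Union> {{s \<in> S. \<phi> s \<in> U} |\<phi> U. \<phi> \<in> \<Phi> \<and> open U}"
    using assms(2) by auto
qed

lemma limitin_weak_topology_on:
  assumes "limitin (weak_topology_on S \<Phi>) s l F" "\<phi> \<in> \<Phi>"
  shows "((\<lambda>n. \<phi> (s n)) \<longlongrightarrow> \<phi> l) F"
  using continuous_map_limit[OF continuous_map_weak_topology_on[OF assms(2)] assms(1)]
  by (simp add: o_def)

text \<open>Open sets arise from subbasic ones by finite intersections and unions, and eventual
  membership passes through both operations; the scalar limits settle the subbasic case.\<close>

lemma limitin_weak_topology_onI:
  assumes "\<Phi> \<noteq> {}" "\<And>n. s n \<in> S" "l \<in> S"
    and lim: "\<And>\<phi>. \<phi> \<in> \<Phi> \<Longrightarrow> ((\<lambda>n. \<phi> (s n)) \<longlongrightarrow> \<phi> l) F"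
  shows "limitin (weak_topology_on S \<Phi>) s l F"
  unfolding limitin_def
proof (intro conjI allI impI)
  show "l \<in> topspace (weak_topology_on S \<Phi>)"
    using assms by (simp add: topspace_weak_topology_on)
  fix U assume U: "openin (weak_topology_on S \<Phi>) U \<and> l \<in> U"
  then have "generate_topology_on {{s \<in> S. \<phi> s \<in> U} |\<phi> U. \<phi> \<in> \<Phi> \<and> open U} U"
    unfolding weak_topology_on_def openin_topology_generated_by_iff by blast
  then show "\<forall>\<^sub>F n in F. s n \<in> U" using conjunct2[OF U]
  proof induction
    case (Int U V)
    then show ?case using eventually_conj[of "\<lambda>n. s n \<in> U" F "\<lambda>n. s n \<in> V"] by simp
  next
    case (UN K)
    then obtain k where "k \<in> K" "\<forall>\<^sub>F n in F. s n \<in> k" by blast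
    then show ?case by (auto elim: eventually_mono)
  next
    case (Basis V)
    then obtain \<phi> W where "V = {s \<in> S. \<phi> s \<in> W}" "\<phi> \<in> \<Phi>" "open W" "\<phi> l \<in> W" by blast
    then show ?case using topological_tendstoD[OF lim, of \<phi> W] assms(2) by simp
  qed simp
qed

lemma limitin_sigmaF:
  "limitin (sigmaF pr) s l F \<Longrightarrow> ((\<lambda>n. pr (s n) x) \<longlongrightarrow> pr l x) F"
  unfolding sigmaF_def by (drule limitin_weak_topology_on[where \<phi> = "\<lambda>f. pr f x"]) auto

section \<open>Pairings and weak-* limits of sequences in F\<close>

lemma antidual_pair_simps:
  assumes "antidual_pair pr"
  shows "pr (f + g) x = pr f x + pr g x" "pr (f - g) x = pr f x - pr g x"
    "pr (c *\<^sub>C f) x = c * pr f x" "pr 0 x = 0"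
    "pr f (x + y) = pr f x + pr f y" "pr f (c *\<^sub>C x) = cnj c * pr f x"
proof -
  have add: "pr (f + g) x = pr f x + pr g x" for f g x
    using assms by (simp add: antidual_pair_def)
  then show "pr (f + g) x = pr f x + pr g x" .
  show "pr 0 x = 0" using add[of 0 0 x] by simp
  show "pr (f - g) x = pr f x - pr g x" using add[of "f - g" g x] by simp
qed (use assms in \<open>simp_all add: antidual_pair_def\<close>)

text \<open>Scalar convergence at every \<open>x\<close> makes \<open>s\<close> Cauchy for
  sigma(F,E): neighbourhoods of 0 are treated by induction on their generation. The limit then comes
  from weak-* sequential completeness, whose definition is unfolded only here.\<close>

lemma weak_star_limit:
  assumes "antidual_pair pr" "weak_star_sequentially_complete pr"
    and conv: "\<And>x. convergent (\<lambda>n. pr (s n) x)"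
  obtains l where "\<And>x. (\<lambda>n. pr (s n) x) \<longlonglongrightarrow> pr l x"
proof -
  note simps = antidual_pair_simps[OF assms(1)]
  have "\<exists>N. \<forall>m\<ge>N. \<forall>n\<ge>N. s m - s n \<in> U" if "openin (sigmaF pr) U" "0 \<in> U" for U
  proof -
    have "generate_topology_on
        {{f \<in> UNIV. \<phi> f \<in> U} |\<phi> U. \<phi> \<in> range (\<lambda>x f. pr f x) \<and> open U} U"
      using that(1) unfolding sigmaF_def weak_topology_on_def openin_topology_generated_by_iff .
    then show ?thesis using that(2)
    proof induction
      case (Int U V)
      then obtain M N where "\<forall>m\<ge>M. \<forall>n\<ge>M. s m - s n \<in> U" "\<forall>m\<ge>N. \<forall>n\<ge>N. s m - s n \<in> V" by blast
      then show ?case by (intro exI[of _ "max M N"]) auto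
    next
      case (UN K)
      then show ?case by blast
    next
      case (Basis S)
      then obtain x U where S: "S = {f. pr f x \<in> U}" "open U" by auto
      \<comment> \<open>Membership of 0 in the subbasic set means \<open>pr 0 x \<in> U\<close>, and
        \<open>pr 0 x = 0\<close>, so the open set \<open>U\<close> contains a ball around
        0.\<close>
      then obtain e where e: "e > 0" "ball 0 e \<subseteq> U"
        using Basis.prems simps(4) open_contains_ball by (metis mem_Collect_eq)
      obtain N where "\<forall>m\<ge>N. \<forall>n\<ge>N. cmod (pr (s m) x - pr (s n) x) < e"
        using convergent_Cauchy[OF conv[of x]] e(1) unfolding Cauchy_iff by blast
      then show ?case using e(2) S(1) by (intro exI[of _ N]) (auto simp: simps dist_norm subset_iff)
    qed auto
  qed
  then obtain l where "limitin (sigmaF pr) s l sequentially"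
    using assms(2) unfolding weak_star_sequentially_complete_def by blast
  then show ?thesis using limitin_sigmaF that by blast
qed

section \<open>Hilbert space geometry\<close>

context complex_semi_inner_space
begin

lemma hnorm_zero: "hnorm ip 0 = 0"
  using ip_scale_left[of 0 0 0] by (simp add: hnorm_def H_closed)

lemma tendsto_ip_left:
  assumes "\<And>n. s n \<in> H" "l \<in> H" "k \<in> H" "((\<lambda>n. hnorm ip (s n - l)) \<longlongrightarrow> 0) F"
  shows "((\<lambda>n. ip (s n) k) \<longlongrightarrow> ip l k) F"
proof (rule LIM_zero_cancel, rule Lim_null_comparison)
  show "\<forall>\<^sub>F n in F. norm (ip (s n) k - ip l k) \<le> hnorm ip (s n - l) * hnorm ip k"
    using assms Cauchy_Schwarz[of "s _ - l" k] by (simp add: ip_diff_left H_closed)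
  show "((\<lambda>n. hnorm ip (s n - l) * hnorm ip k) \<longlongrightarrow> 0) F"
    using tendsto_mult_right[OF assms(4), of "hnorm ip k"] by simp
qed

lemma abs_hnorm_diff:
  assumes "h \<in> H" "k \<in> H" shows "\<bar>hnorm ip h - hnorm ip k\<bar> \<le> hnorm ip (h - k)"
  using hnorm_triangle[of "h - k" k] hnorm_triangle[of "k - h" h] hnorm_diff_commute[of h k] assms
  by (simp add: H_closed)

lemma tendsto_hnorm:
  assumes "\<And>n. s n \<in> H" "l \<in> H" "((\<lambda>n. hnorm ip (s n - l)) \<longlongrightarrow> 0) F"
  shows "((\<lambda>n. hnorm ip (s n)) \<longlongrightarrow> hnorm ip l) F"
  by (rule LIM_zero_cancel, rule Lim_null_comparison[OF _ assms(3)])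
    (simp add: abs_hnorm_diff assms)

lemma hnorm_add_square:
  assumes "h \<in> H" "k \<in> H"
  shows "(hnorm ip (h + k))\<^sup>2 = (hnorm ip h)\<^sup>2 + (hnorm ip k)\<^sup>2 + 2 * Re (ip h k)"
  using assms
  by (simp add: ip_add_left ip_add_right H_closed ip_commute[of k h] flip: Re_ip_self)

lemma hnorm_diff_square:
  assumes "h \<in> H" "k \<in> H"
  shows "(hnorm ip (h - k))\<^sup>2 = (hnorm ip h)\<^sup>2 + (hnorm ip k)\<^sup>2 - 2 * Re (ip h k)"
  using assms
  by (simp add: ip_diff_left ip_diff_right H_closed ip_commute[of k h] flip: Re_ip_self)

lemma hnorm_scale:
  assumes "h \<in> H" shows "hnorm ip (c *\<^sub>C h) = cmod c * hnorm ip h"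
proof -
  have "ip (c *\<^sub>C h) (c *\<^sub>C h) = (c * cnj c) * ip h h"
    using assms by (simp add: ip_scale_left ip_scale_right H_closed)
  also have "\<dots> = complex_of_real ((cmod c * hnorm ip h)\<^sup>2)"
    by (simp only: ip_self_complex[OF assms] power_mult_distrib complex_norm_square of_real_mult)
  finally have "(hnorm ip (c *\<^sub>C h))\<^sup>2 = (cmod c * hnorm ip h)\<^sup>2"
    using assms by (metis Re_complex_of_real Re_ip_self H_closed(4))
  then show ?thesis using assms by (simp add: hnorm_nonneg H_closed)
qed

end

context complex_inner_space
begin

lemma ip_ext:
  assumes "h \<in> H" "k \<in> H" "\<And>l. l \<in> H \<Longrightarrow> ip h l = ip k l" shows "h = k"
  using ip_definite[of "h - k"] assms by (simp add: ip_diff_left H_closed)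

lemma topspace_htopology: "topspace (htopology H ip) = H"
  by (simp add: htopology_def Metric_space.topspace_mtopology[OF Metric_space_hdist])

lemma openin_htopology_ball:
  assumes "h \<in> H" shows "openin (htopology H ip) {k \<in> H. hnorm ip (h - k) < e}"
proof -
  interpret D: Metric_space H "hdist H ip" by (rule Metric_space_hdist)
  have "D.mball h e = {k \<in> H. hnorm ip (h - k) < e}"
    using assms by (auto simp: D.mball_def hdist_def)
  then show ?thesis unfolding htopology_def by (metis D.openin_mball)
qed

lemma htopology_openE:
  assumes "openin (htopology H ip) U" "h \<in> U"
  obtains e where "e > 0" "\<And>k. k \<in> H \<Longrightarrow> hnorm ip (h - k) < e \<Longrightarrow> k \<in> U"
proof -
  interpret D: Metric_space H "hdist H ip" by (rule Metric_space_hdist)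
  obtain e where e: "e > 0" "D.mball h e \<subseteq> U"
    using assms unfolding htopology_def D.openin_mtopology by blast
  have "h \<in> H" using openin_subset[OF assms(1)] assms(2) topspace_htopology by blast
  then show ?thesis using e by (intro that[of e]) (auto simp: D.mball_def hdist_def subset_iff)
qed

lemma closure_of_htopology:
  "h \<in> htopology H ip closure_of S \<longleftrightarrow> h \<in> H \<and> (\<forall>e>0. \<exists>k \<in> S \<inter> H. hnorm ip (h - k) < e)"
proof -
  interpret D: Metric_space H "hdist H ip" by (rule Metric_space_hdist)
  show ?thesis unfolding htopology_def D.metric_closure_of
    by (auto simp: D.mball_def hdist_def)
qed

end

context complex_hilbert_space
begin

text \<open>Completeness rephrased through \<open>hnorm\<close>, so that later arguments avoid
  \<open>hdist\<close> and its default value off \<open>H\<close>.\<close>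

lemma Cauchy_limit:
  assumes "\<And>n. s n \<in> H" "\<And>e. e > 0 \<Longrightarrow> \<exists>N. \<forall>m\<ge>N. \<forall>n\<ge>N. hnorm ip (s m - s n) < e"
  obtains l where "l \<in> H" "(\<lambda>n. hnorm ip (s n - l)) \<longlonglongrightarrow> 0"
proof -
  interpret D: Metric_space H "hdist H ip" by (rule Metric_space_hdist)
  have "D.MCauchy s" using assms unfolding D.MCauchy_def hdist_def by auto
  then obtain l where l: "limitin D.mtopology s l sequentially"
    using complete unfolding D.mcomplete_def by blast
  then have "l \<in> H" using D.limitin_mspace by blast
  moreover have "(\<lambda>n. hnorm ip (s n - l)) \<longlonglongrightarrow> 0"
  proof (rule LIMSEQ_I)
    fix e :: real assume "e > 0"
    then obtain N where "\<forall>n\<ge>N. hdist H ip (s n) l < e"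
      using l unfolding D.limitin_metric eventually_sequentially by blast
    then show "\<exists>no. \<forall>n\<ge>no. norm (hnorm ip (s n - l) - 0) < e"
      using assms(1) \<open>l \<in> H\<close> by (auto simp: hdist_def hnorm_nonneg H_closed)
  qed
  ultimately show ?thesis by (rule that)
qed

end

section \<open>Orthogonal projection onto a closed subspace\<close>

locale hilbert_closed_subspace = complex_hilbert_space +
  fixes M
  assumes M_subspace: "complex_vector.subspace M" and M_sub: "M \<subseteq> H"
    and M_closed: "\<lbrakk>h \<in> H; \<And>e. e > 0 \<Longrightarrow> \<exists>m\<in>M. hnorm ip (h - m) < e\<rbrakk> \<Longrightarrow> h \<in> M"
begin

lemma M_in_H: "m \<in> M \<Longrightarrow> m \<in> H" using M_sub by blast

lemmas M_lin = complex_vector.subspace_0[OF M_subspace] complex_vector.subspace_add[OF M_subspace]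
  complex_vector.subspace_diff[OF M_subspace] complex_vector.subspace_scale[OF M_subspace]

text \<open>A minimizing sequence is Cauchy by the parallelogram law; its limit stays in
  \<open>M\<close> by closedness and attains the infimum \<open>d\<close> of the squared
  distances.\<close>

lemma nearest_point:
  assumes h: "h \<in> H"
  obtains p where "p \<in> M" "\<And>m. m \<in> M \<Longrightarrow> hnorm ip (h - p) \<le> hnorm ip (h - m)"
proof -
  define d where "d = (INF m\<in>M. (hnorm ip (h - m))\<^sup>2)"
  have bdd: "bdd_below ((\<lambda>m. (hnorm ip (h - m))\<^sup>2) ` M)" by (rule bdd_belowI[of _ 0]) auto
  have d_le: "d \<le> (hnorm ip (h - m))\<^sup>2" if "m \<in> M" for m
    unfolding d_def using bdd that by (rule cINF_lower)
  have "\<exists>m\<in>M. (hnorm ip (h - m))\<^sup>2 < d + 1 / real (Suc n)" for n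
  proof -
    have "d < d + 1 / real (Suc n)" by simp
    then show ?thesis
      unfolding d_def using cINF_less_iff[OF _ bdd] M_lin(1) by blast
  qed
  then obtain s where sM: "\<And>n. s n \<in> M" and s: "\<And>n. (hnorm ip (h - s n))\<^sup>2 < d + 1 / real (Suc n)"
    by metis
  have sH: "s n \<in> H" for n using sM M_in_H by blast
  have par: "(hnorm ip (s i - s j))\<^sup>2 \<le> 2 / real (Suc i) + 2 / real (Suc j)" for i j
  proof -
    define a b where "a = h - s i" and "b = h - s j"
    have ab: "a \<in> H" "b \<in> H" using h sH by (auto simp: a_def b_def H_closed)
    \<comment> \<open>The midpoint lies in \<open>M\<close>, so \<open>a + b = 2 (h - m)\<close> has
      squared norm at least \<open>4 * d\<close>. In the parallelogram identity this leaves only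
      twice the excesses of the squared norms of \<open>a\<close> and \<open>b\<close> over
      \<open>d\<close>.\<close>
    define m where "m = (1/2) *\<^sub>C (s i + s j)"
    have "m \<in> M" using sM M_lin by (simp add: m_def)
    have "2 *\<^sub>C m = s i + s j" by (simp add: m_def scaleC_scaleC)
    moreover have "2 *\<^sub>C h = h + h" using scaleC_add_left[of 1 1 h] by (simp add: scaleC_one)
    ultimately have "a + b = 2 *\<^sub>C (h - m)"
      by (simp add: a_def b_def complex_vector.scale_right_diff_distrib)
    then have "(hnorm ip (a + b))\<^sup>2 = 4 * (hnorm ip (h - m))\<^sup>2"
      using h M_in_H[OF \<open>m \<in> M\<close>] by (simp add: hnorm_scale H_closed power_mult_distrib)
    then have "4 * d \<le> (hnorm ip (a + b))\<^sup>2" using d_le[OF \<open>m \<in> M\<close>] by simp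
    moreover have "s i - s j = b - a" by (simp add: a_def b_def)
    ultimately show ?thesis
      using hnorm_add_square[OF ab(2,1)] hnorm_diff_square[OF ab(2,1)] s[of i] s[of j]
      by (simp add: a_def[symmetric] b_def[symmetric] add.commute[of b a])
  qed
  have "\<exists>N. \<forall>m\<ge>N. \<forall>n\<ge>N. hnorm ip (s m - s n) < e" if "e > 0" for e
  proof -
    have "e\<^sup>2 / 4 > 0" using that by simp
    then obtain N where N: "1 / real (Suc N) < e\<^sup>2 / 4" using nat_approx_posE by blast
    have "hnorm ip (s m - s n) < e" if mn: "m \<ge> N" "n \<ge> N" for m n
    proof (rule power2_less_imp_less)
      have "2 / real (Suc k) \<le> 2 / real (Suc N)" if "k \<ge> N" for k
        using that by (simp add: frac_le)
      from this[OF mn(1)] this[OF mn(2)]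
      show "(hnorm ip (s m - s n))\<^sup>2 < e\<^sup>2" using par[of m n] N by simp
    qed (use \<open>e > 0\<close> in simp)
    then show ?thesis by blast
  qed
  from Cauchy_limit[OF sH this] obtain p where p: "p \<in> H" "(\<lambda>n. hnorm ip (s n - p)) \<longlonglongrightarrow> 0" by blast
  have "p \<in> M"
  proof (rule M_closed[OF p(1)])
    fix e :: real assume "e > 0"
    then obtain n where "hnorm ip (s n - p) < e"
      using LIMSEQ_D[OF p(2), of e] by (metis abs_less_iff diff_zero order_refl real_norm_def)
    then show "\<exists>m\<in>M. hnorm ip (p - m) < e"
      using sM sH p(1) hnorm_diff_commute by metis
  qed
  have "(\<lambda>n. hnorm ip (h - s n)) \<longlonglongrightarrow> hnorm ip (h - p)"
    using p h sH by (intro tendsto_hnorm) (auto simp: H_closed hnorm_diff_commute)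
  then have lim: "(\<lambda>n. (hnorm ip (h - s n))\<^sup>2) \<longlonglongrightarrow> (hnorm ip (h - p))\<^sup>2" by (intro tendsto_intros)
  have lim_d: "(\<lambda>n. d + 1 / real (Suc n)) \<longlonglongrightarrow> d + 0"
    by (intro tendsto_intros LIMSEQ_Suc lim_1_over_n)
  have "(hnorm ip (h - p))\<^sup>2 \<le> d + 0"
    by (rule LIMSEQ_le[OF lim lim_d]) (intro exI allI impI less_imp_le s)
  have "hnorm ip (h - p) \<le> hnorm ip (h - m)" if "m \<in> M" for m
  proof (rule power2_le_imp_le)
    show "(hnorm ip (h - p))\<^sup>2 \<le> (hnorm ip (h - m))\<^sup>2"
      using d_le[OF that] \<open>(hnorm ip (h - p))\<^sup>2 \<le> d + 0\<close> by linarith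
    show "0 \<le> hnorm ip (h - m)" using h M_in_H[OF that] by (simp add: hnorm_nonneg H_closed)
  qed
  then show ?thesis using that \<open>p \<in> M\<close> by blast
qed

text \<open>Moving the nearest point along \<open>m\<close> cannot shorten \<open>h - p\<close>,
  which forces orthogonality; two candidates differ by a vector of \<open>M\<close> orthogonal to
  itself. This justifies the description by \<open>THE\<close> in \<open>orth_proj\<close>.\<close>

lemma projection_ex1:
  assumes h: "h \<in> H"
  shows "\<exists>!p. p \<in> M \<and> (\<forall>m\<in>M. ip (h - p) m = 0)"
proof -
  obtain p where p: "p \<in> M" "\<And>m. m \<in> M \<Longrightarrow> hnorm ip (h - p) \<le> hnorm ip (h - m)"
    using nearest_point[OF h] by blast
  define a where "a = h - p"
  have a: "a \<in> H" using h p M_in_H by (simp add: a_def H_closed)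
  have "ip a m = 0" if m: "m \<in> M" for m
  proof (rule ccontr)
    define b c where "b = ip a m" and "c = (hnorm ip m)\<^sup>2"
    \<comment> \<open>The optimal coefficient would be \<open>b / c\<close>. The denominator
      \<open>c + 1\<close> avoids a case distinction on \<open>c = 0\<close> and still shortens
      \<open>a\<close> strictly, because \<open>c / (c + 1)^2 \<le> 1 / (c + 1)\<close>.\<close>
    define t where "t = b / complex_of_real (c + 1)"
    assume "ip a m \<noteq> 0"
    then have b: "cmod b > 0" by (simp add: b_def)
    have mH: "m \<in> H" using m M_in_H by blast
    have c: "c \<ge> 0" by (simp add: c_def)
    have "hnorm ip a \<le> hnorm ip (a - t *\<^sub>C m)"
      using p(2)[of "p + t *\<^sub>C m"] p(1) m M_lin by (simp add: a_def diff_diff_eq)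
    then have "(hnorm ip a)\<^sup>2 \<le> (hnorm ip (a - t *\<^sub>C m))\<^sup>2"
      using a by (intro power_mono hnorm_nonneg)
    also have "\<dots> = (hnorm ip a)\<^sup>2 + (cmod t)\<^sup>2 * c - 2 * Re (cnj t * b)"
      using a mH by (simp add: hnorm_diff_square H_closed hnorm_scale ip_scale_right c_def b_def
          power_mult_distrib)
    also have "cnj t * b = complex_of_real ((cmod b)\<^sup>2 / (c + 1))"
      by (simp add: t_def complex_norm_square mult.commute del: of_real_power of_real_add)
    also have "(cmod t)\<^sup>2 = (cmod b)\<^sup>2 / (c + 1)\<^sup>2"
      using c by (simp add: t_def norm_divide power_divide del: of_real_add)
    finally have le: "2 * ((cmod b)\<^sup>2 / (c + 1)) \<le> (cmod b)\<^sup>2 / (c + 1)\<^sup>2 * c" by simp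
    have "c / (c + 1)\<^sup>2 \<le> (c + 1) / (c + 1)\<^sup>2"
      by (intro divide_right_mono) auto
    then have "(cmod b)\<^sup>2 * (c / (c + 1)\<^sup>2) \<le> (cmod b)\<^sup>2 * (1 / (c + 1))"
      using c by (intro mult_left_mono) (auto simp: power2_eq_square)
    then have "(cmod b)\<^sup>2 / (c + 1)\<^sup>2 * c \<le> (cmod b)\<^sup>2 / (c + 1)" by simp
    moreover have "(cmod b)\<^sup>2 / (c + 1) > 0" using b c by simp
    ultimately show False using le by linarith
  qed
  moreover have "q = q'"
    if "q \<in> M" "q' \<in> M" "\<forall>m\<in>M. ip (h - q) m = 0" "\<forall>m\<in>M. ip (h - q') m = 0" for q q'
  proof -
    have "q - q' \<in> M" using that M_lin by blast
    moreover have "(h - q') - (h - q) = q - q'" by simp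
    then have "ip (q - q') (q - q') = ip (h - q') (q - q') - ip (h - q) (q - q')"
      using ip_diff_left[of "h - q'" "h - q" "q - q'"] that h by (simp only: H_closed M_in_H)
    ultimately have "ip (q - q') (q - q') = 0" using that by simp
    then show ?thesis using ip_definite[of "q - q'"] \<open>q - q' \<in> M\<close> M_in_H by simp
  qed
  ultimately show ?thesis using p(1) by (auto simp: a_def)
qed

abbreviation "P \<equiv> orth_proj ip M"

lemma P_in_M: "h \<in> H \<Longrightarrow> P h \<in> M"
  and P_orth: "h \<in> H \<Longrightarrow> m \<in> M \<Longrightarrow> ip (h - P h) m = 0"
  using theI'[OF projection_ex1[of h]] unfolding orth_proj_def by auto

lemma P_in_H: "h \<in> H \<Longrightarrow> P h \<in> H" using P_in_M M_in_H by blast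

lemma P_eqI: "h \<in> H \<Longrightarrow> p \<in> M \<Longrightarrow> (\<And>m. m \<in> M \<Longrightarrow> ip (h - p) m = 0) \<Longrightarrow> P h = p"
  using projection_ex1[of h] P_in_M[of h] P_orth[of h] by blast

lemma P_id: "m \<in> M \<Longrightarrow> P m = m"
  using ip_diff_left[of m m] by (intro P_eqI) (auto simp: M_in_H)

lemma P_add:
  assumes "h \<in> H" "k \<in> H" shows "P (h + k) = P h + P k"
proof (rule P_eqI)
  show "ip (h + k - (P h + P k)) m = 0" if "m \<in> M" for m
    using ip_add_left[of "h - P h" "k - P k" m] assms that
    by (simp add: P_orth P_in_H M_in_H H_closed algebra_simps)
qed (use assms P_in_M M_lin in \<open>auto simp: H_closed\<close>)

lemma P_scale:
  assumes "h \<in> H" shows "P (c *\<^sub>C h) = c *\<^sub>C P h"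
proof (rule P_eqI)
  show "ip (c *\<^sub>C h - c *\<^sub>C P h) m = 0" if "m \<in> M" for m
    using ip_scale_left[of "h - P h" m c] assms that
    by (simp add: P_orth P_in_H M_in_H H_closed complex_vector.scale_right_diff_distrib)
qed (use assms P_in_M M_lin in \<open>auto simp: H_closed\<close>)

lemma P_diff: "h \<in> H \<Longrightarrow> k \<in> H \<Longrightarrow> P (h - k) = P h - P k"
  using P_add[of "h - k" k] by (simp add: H_closed)

text \<open>Orthogonality of \<open>h - P h\<close> and \<open>P h\<close> allows the second
  argument to be projected too. With the analogous fact for \<open>h - P h\<close>, this turns the
  quadratic forms of \<open>Bs\<close> and \<open>Ba\<close> into squared norms.\<close>

lemma ip_P_self:
  assumes "h \<in> H" shows "ip (P h) h = ip (P h) (P h)"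
  using P_orth[OF assms P_in_M[OF assms]] ip_diff_right[of h "P h" "P h"] assms
    ip_commute[of "P h" "h - P h"]
  by (simp add: P_in_H H_closed)

lemma ip_P_compl_self:
  assumes "h \<in> H" shows "ip (h - P h) h = ip (h - P h) (h - P h)"
  using P_orth[OF assms P_in_M[OF assms]] ip_diff_right[of h "P h" "h - P h"] assms
  by (simp add: P_in_H H_closed)

text \<open>Pythagoras: the squared norm of \<open>h - P h\<close> is the difference of the squared
  norms of \<open>h\<close> and \<open>P h\<close>, and it is nonnegative.\<close>

lemma hnorm_P_le:
  assumes "h \<in> H" shows "hnorm ip (P h) \<le> hnorm ip h"
proof (rule power2_le_imp_le)
  have "Re (ip h (P h)) = (hnorm ip (P h))\<^sup>2"
    using ip_P_self[OF assms] ip_commute[of h "P h"] assms by (simp add: P_in_H Re_ip_self)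
  then show "(hnorm ip (P h))\<^sup>2 \<le> (hnorm ip h)\<^sup>2"
    using hnorm_diff_square[of h "P h"] assms zero_le_power2[of "hnorm ip (h - P h)"]
    by (simp add: P_in_H)
qed (simp add: hnorm_nonneg assms)

end

section \<open>Positive operators and their seminorms\<close>

text \<open>The seminorm of the semi-inner product \<open>pr (D x) y\<close>. Expressing it by
  \<open>hnorm\<close> makes the triangle and Cauchy-Schwarz inequalities available for every
  positive \<open>D\<close>.\<close>

abbreviation form_norm ::
  "('f::complex_vector \<Rightarrow> 'e::complex_vector \<Rightarrow> complex) \<Rightarrow> ('e \<Rightarrow> 'f) \<Rightarrow> 'e \<Rightarrow> real"
  where "form_norm pr D \<equiv> hnorm (\<lambda>x. pr (D x))"

lemma antidual_pair_ext:
  assumes "antidual_pair pr" "\<And>x. pr f x = pr g x" shows "f = g"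
proof -
  have "pr (f - g) x = 0" for x using assms by (simp add: antidual_pair_simps)
  then have "f - g = 0" using assms(1) unfolding antidual_pair_def by blast
  then show ?thesis by simp
qed

lemma clinear_antidual_pairI:
  assumes "antidual_pair pr"
    and "\<And>x y z. pr (D (x + y)) z = pr (D x) z + pr (D y) z"
    and "\<And>c x z. pr (D (c *\<^sub>C x)) z = c * pr (D x) z"
  shows "clinear D"
  unfolding Vector_Spaces.linear_iff
  using assms(2,3)
  by (auto intro!: complex_vector.vector_space_axioms antidual_pair_ext[OF assms(1)] simp: antidual_pair_simps[OF assms(1)])

lemma positive_op_linear:
  assumes "positive_op pr D"
  shows "D (x + y) = D x + D y" "D (c *\<^sub>C x) = c *\<^sub>C D x"
  using assms by (simp_all add: positive_op_def Vector_Spaces.linear_iff)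

text \<open>Polarization: the quadratic form is real at \<open>x\<close>, \<open>y\<close>,
  \<open>x + y\<close> and \<open>x + \<i> y\<close>, which forces Hermitian symmetry.\<close>

lemma positive_op_semi_inner_space:
  assumes "antidual_pair pr" "positive_op pr D"
  shows "complex_semi_inner_space UNIV (\<lambda>x. pr (D x))"
proof
  note simps = antidual_pair_simps[OF assms(1)] positive_op_linear[OF assms(2)]
  show self: "pr (D x) x \<in> \<real>\<^sub>\<ge>\<^sub>0" for x
    using assms(2) by (simp add: positive_op_def)
  then have im: "Im (pr (D x) x) = 0" for x by (metis complex_is_Real_iff nonneg_Reals_Real)
  show "pr (D x) y = cnj (pr (D y) x)" for x y
    using im[of "x + y"] im[of "x + \<i> *\<^sub>C y"] im[of x] im[of y]
    by (auto simp: simps complex_eq_iff)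
qed (simp_all add: antidual_pair_simps[OF assms(1)] positive_op_linear[OF assms(2)])

lemma positive_op_commute:
  assumes "antidual_pair pr" "positive_op pr D"
  shows "pr (D x) y = cnj (pr (D y) x)"
  by (rule complex_semi_inner_space.ip_commute[OF positive_op_semi_inner_space[OF assms]]) auto

text \<open>By symmetry, \<open>pr (D x) y\<close> is the conjugate of \<open>pr (D y) x\<close>,
  which is weakly continuous in \<open>x\<close> by the very definition of sigma(E,F).\<close>

lemma positive_op_weak_operators:
  assumes "antidual_pair pr" "positive_op pr D"
  shows "D \<in> weak_operators pr"
proof -
  have "continuous_map (sigmaE pr) euclidean (\<lambda>x. pr (D x) y)" for y
  proof -
    have "continuous_map (sigmaE pr) euclidean (\<lambda>x. cnj (pr (D y) x))"
      unfolding sigmaE_def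
      by (rule continuous_map_compose[of _ euclidean _ _ cnj, unfolded o_def])
        (auto intro!: continuous_map_weak_topology_on continuous_intros)
    then show ?thesis using positive_op_commute[OF assms, of _ y] by simp
  qed
  then have "continuous_map (sigmaE pr) (sigmaF pr) D"
    unfolding sigmaF_def by (intro continuous_map_into_weak_topology_on) auto
  then show ?thesis using assms(2) by (simp add: weak_operators_def positive_op_def)
qed

lemma positive_op_self:
  assumes "antidual_pair pr" "positive_op pr D"
  shows "pr (D x) x = complex_of_real ((form_norm pr D x)\<^sup>2)"
  by (rule complex_semi_inner_space.ip_self_complex[OF positive_op_semi_inner_space[OF assms]]) auto

lemma form_norm_mono:
  assumes "antidual_pair pr" "op_le pr C D"
  shows "form_norm pr C x \<le> form_norm pr D x"
proof -
  have "pr (D x) x - pr (C x) x \<in> \<real>\<^sub>\<ge>\<^sub>0"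
    using assms by (simp add: op_le_def positive_op_def antidual_pair_simps)
  then show ?thesis by (simp add: hnorm_def complex_nonneg_Reals_iff)
qed

lemma op_leI:
  assumes "antidual_pair pr" "positive_op pr C" "positive_op pr D"
    and "\<And>x. form_norm pr C x \<le> form_norm pr D x"
  shows "op_le pr C D"
  unfolding op_le_def positive_op_def
proof (intro conjI allI)
  note simps = antidual_pair_simps[OF assms(1)] positive_op_linear[OF assms(2)]
    positive_op_linear[OF assms(3)]
  show "clinear (\<lambda>x. D x - C x)"
    by (rule clinear_antidual_pairI[OF assms(1)]) (simp_all add: simps algebra_simps)
  show "pr (D x - C x) x \<in> \<real>\<^sub>\<ge>\<^sub>0" for x
    using power_mono[OF assms(4)[of x], of 2]
      complex_semi_inner_space.hnorm_nonneg[OF positive_op_semi_inner_space[OF assms(1,2)], of x]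
    by (simp add: simps positive_op_self[OF assms(1,2)] positive_op_self[OF assms(1,3)]
        complex_nonneg_Reals_iff)
qed

text \<open>By Cauchy-Schwarz a vanishing seminorm annihilates every \<open>pr (D x) y\<close>, and
  the pairing separates the points of F.\<close>

lemma positive_op_eq_0:
  assumes "antidual_pair pr" "positive_op pr D" "\<And>x. form_norm pr D x = 0"
  shows "D = (\<lambda>x. 0)"
proof
  fix x
  interpret complex_semi_inner_space UNIV "\<lambda>x. pr (D x)"
    by (rule positive_op_semi_inner_space[OF assms(1,2)])
  have "pr (D x) y = 0" for y using Cauchy_Schwarz[of x y] assms(3) by simp
  then show "D x = 0" by (intro antidual_pair_ext[OF assms(1)]) (simp add: antidual_pair_simps[OF assms(1)])
qed

lemma tendsto_complex_square_iff:
  "((\<lambda>n. complex_of_real ((r n)\<^sup>2)) \<longlongrightarrow> 0) F \<longleftrightarrow> (r \<longlongrightarrow> 0) F"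
proof -
  have "((\<lambda>n. complex_of_real ((r n)\<^sup>2)) \<longlongrightarrow> 0) F \<longleftrightarrow> ((\<lambda>n. (r n)\<^sup>2) \<longlongrightarrow> 0) F"
    using tendsto_of_real_iff[where 'a = complex, of "\<lambda>n. (r n)\<^sup>2" 0 F] by simp
  also have "\<dots> \<longleftrightarrow> (r \<longlongrightarrow> 0) F"
  proof
    assume "((\<lambda>n. (r n)\<^sup>2) \<longlongrightarrow> 0) F"
    then have "((\<lambda>n. sqrt ((r n)\<^sup>2)) \<longlongrightarrow> sqrt 0) F" by (rule tendsto_real_sqrt)
    then show "(r \<longlongrightarrow> 0) F" by (simp add: tendsto_rabs_zero_iff)
  next
    assume "(r \<longlongrightarrow> 0) F"
    from tendsto_power[OF this, of 2] show "((\<lambda>n. (r n)\<^sup>2) \<longlongrightarrow> 0) F" by simp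
  qed
  finally show ?thesis .
qed

text \<open>Passing from complex forms along a product filter to real seminorms and an epsilon
  condition makes the triangle inequality directly applicable.\<close>

lemma abs_cont_iff:
  assumes "antidual_pair pr" "positive_op pr A" "positive_op pr B"
  shows "abs_cont pr B A \<longleftrightarrow>
    (\<forall>x :: nat \<Rightarrow> _. (\<lambda>n. form_norm pr A (x n)) \<longlonglongrightarrow> 0 \<and>
      (\<forall>e>0. \<exists>N. \<forall>m\<ge>N. \<forall>n\<ge>N. form_norm pr B (x m - x n) < e) \<longrightarrow>
      (\<lambda>n. form_norm pr B (x n)) \<longlonglongrightarrow> 0)"
proof -
  interpret B: complex_semi_inner_space UNIV "\<lambda>x. pr (B x)"
    by (rule positive_op_semi_inner_space[OF assms(1,3)])
  have "((\<lambda>(n, m). pr (B (x n - x m)) (x n - x m)) \<longlongrightarrow> 0) (sequentially \<times>\<^sub>F sequentially) \<longleftrightarrow>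
    (\<forall>e>0. \<exists>N. \<forall>m\<ge>N. \<forall>n\<ge>N. form_norm pr B (x m - x n) < e)" for x :: "nat \<Rightarrow> _"
  proof -
    have "((\<lambda>(n, m). pr (B (x n - x m)) (x n - x m)) \<longlongrightarrow> 0) (sequentially \<times>\<^sub>F sequentially) \<longleftrightarrow>
      ((\<lambda>p. form_norm pr B (x (fst p) - x (snd p))) \<longlongrightarrow> 0) (sequentially \<times>\<^sub>F sequentially)"
      unfolding tendsto_complex_square_iff[symmetric] positive_op_self[OF assms(1,3), symmetric]
      by (simp add: case_prod_unfold)
    also have "\<dots> \<longleftrightarrow> (\<forall>e>0. \<exists>N. \<forall>m\<ge>N. \<forall>n\<ge>N. form_norm pr B (x m - x n) < e)"
      by (simp add: tendsto_iff eventually_prod_sequentially dist_norm B.hnorm_nonneg) blast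
    finally show ?thesis .
  qed
  moreover have "(\<lambda>n. pr (A (x n)) (x n)) \<longlonglongrightarrow> 0 \<longleftrightarrow> (\<lambda>n. form_norm pr A (x n)) \<longlonglongrightarrow> 0"
    "(\<lambda>n. pr (B (x n)) (x n)) \<longlonglongrightarrow> 0 \<longleftrightarrow> (\<lambda>n. form_norm pr B (x n)) \<longlonglongrightarrow> 0" for x :: "nat \<Rightarrow> _"
    unfolding tendsto_complex_square_iff[symmetric] positive_op_self[OF assms(1,3), symmetric]
      positive_op_self[OF assms(1,2), symmetric] by simp_all
  ultimately show ?thesis unfolding abs_cont_def by simp
qed

section \<open>The factorization through the auxiliary Hilbert space\<close>

locale positive_completion = hilbert_completion pr A H ip \<iota>
  for pr :: "'f::complex_vector \<Rightarrow> 'e::complex_vector \<Rightarrow> complex"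
    and A :: "'e \<Rightarrow> 'f"
    and H :: "'h::complex_vector set" and ip :: "'h \<Rightarrow> 'h \<Rightarrow> complex"
    and \<iota> :: "'f \<Rightarrow> 'h" +
  assumes pair: "antidual_pair pr" and weak_complete: "weak_star_sequentially_complete pr"
    and pos: "positive_op pr A"
begin

text \<open>This vector turns out to be the adjoint of \<open>J\<close> at \<open>x\<close>. In the
  locale with both operators, \<open>a.v\<close> and \<open>b.v\<close> are the maps called
  \<open>u\<close> and \<open>v\<close> in the opening text.\<close>

abbreviation "v x \<equiv> \<iota> (A x)"

lemma v_lin: "v (x + y) = v x + v y" "v (c *\<^sub>C x) = c *\<^sub>C v x" "v (x - y) = v x - v y"
proof -
  show add: "v (x + y) = v x + v y" for x y
    by (simp add: positive_op_linear[OF pos] iota_add)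
  show "v (c *\<^sub>C x) = c *\<^sub>C v x"
    by (simp add: positive_op_linear[OF pos] iota_scale)
  show "v (x - y) = v x - v y" using add[of "x - y" y] by simp
qed

lemma hnorm_v: "hnorm ip (v x) = form_norm pr A x"
  by (simp add: hnorm_def iota_isometric)

lemma v_dense:
  assumes "h \<in> H"
  obtains x where "\<And>n::nat. hnorm ip (v (x n) - h) < 1 / real (Suc n)"
proof -
  have "\<exists>x. hnorm ip (v x - h) < 1 / real (Suc n)" for n
  proof -
    have "h \<in> htopology H ip closure_of (\<iota> ` range A)" using assms iota_dense by simp
    then have "\<exists>k\<in>\<iota> ` range A \<inter> H. hnorm ip (h - k) < 1 / real (Suc n)"
      unfolding closure_of_htopology by simp
    then show ?thesis using assms iota_in hnorm_diff_commute by auto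
  qed
  then show ?thesis using that by metis
qed

lemma v_dense_lim:
  assumes "h \<in> H"
  obtains x where "(\<lambda>n. hnorm ip (v (x n) - h)) \<longlonglongrightarrow> 0"
proof -
  obtain x where x: "\<And>n::nat. hnorm ip (v (x n) - h) < 1 / real (Suc n)" using v_dense[OF assms] by blast
  have "norm (hnorm ip (v (x n) - h)) \<le> 1 / real (Suc n)" for n
    using x[of n] assms by (simp add: hnorm_nonneg H_closed iota_in)
  then have "(\<lambda>n. hnorm ip (v (x n) - h)) \<longlonglongrightarrow> 0"
    by (intro Lim_null_comparison[OF always_eventually LIMSEQ_Suc[OF lim_1_over_n]]) blast
  then show ?thesis by (rule that)
qed

text \<open>If \<open>v (y n)\<close> tends to \<open>h\<close>, the scalars
  \<open>pr (A (y n)) x\<close> tend to \<open>ip h (v x)\<close> for every \<open>x\<close>;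
  sequential completeness supplies an element of F representing the limit.\<close>

lemma Riesz_representative_in_F:
  obtains J where "J \<in> extensional H" "\<And>h x. h \<in> H \<Longrightarrow> pr (J h) x = ip h (v x)"
proof -
  have "\<exists>f. \<forall>x. pr f x = ip h (v x)" if h: "h \<in> H" for h
  proof -
    obtain y where y: "(\<lambda>n. hnorm ip (v (y n) - h)) \<longlonglongrightarrow> 0" using v_dense_lim[OF h] by blast
    have lim: "(\<lambda>n. pr (A (y n)) x) \<longlonglongrightarrow> ip h (v x)" for x
      using tendsto_ip_left[OF iota_in h iota_in y, of x] by (simp add: iota_isometric)
    then have "convergent (\<lambda>n. pr (A (y n)) x)" for x by (rule convergentI)
    from weak_star_limit[OF pair weak_complete this]
    obtain f where "\<And>x. (\<lambda>n. pr (A (y n)) x) \<longlonglongrightarrow> pr f x" by blast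
    then have "pr f x = ip h (v x)" for x using lim by (rule LIMSEQ_unique)
    then show ?thesis by blast
  qed
  then have "\<forall>h\<in>H. \<exists>f. \<forall>x. pr f x = ip h (v x)" by blast
  then obtain J where "\<forall>h\<in>H. \<forall>x. pr (J h) x = ip h (v x)" unfolding bchoice_iff by blast
  then have "pr (restrict J H h) x = ip h (v x)" if "h \<in> H" for h x using that by simp
  then show ?thesis by (rule that[OF restrict_extensional])
qed

abbreviation "J \<equiv> J_op pr A H ip \<iota>"

text \<open>The map \<open>J0\<close> built from the representatives meets the description in
  \<open>J_op\<close>, and any map meeting it satisfies the same formula. The formula is all that
  later arguments use about \<open>J\<close>.\<close>

lemma pr_J:
  assumes "h \<in> H" shows "pr (J h) x = ip h (v x)"
proof -
  define is_J where "is_J J \<longleftrightarrow> J \<in> extensional H \<and>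
    (\<forall>h\<in>H. \<forall>k\<in>H. J (h + k) = J h + J k) \<and>
    (\<forall>c. \<forall>h\<in>H. J (c *\<^sub>C h) = c *\<^sub>C J h) \<and>
    continuous_map (hweak H ip) (sigmaF pr) J \<and>
    (\<forall>f \<in> range A. J (\<iota> f) = f)" for J
  obtain J0 where J0: "J0 \<in> extensional H" "\<And>h x. h \<in> H \<Longrightarrow> pr (J0 h) x = ip h (v x)"
    using Riesz_representative_in_F by blast
  have hw: "((\<lambda>k h. ip h k) ` H) \<noteq> {}" using H_closed(1) by blast
  \<comment> \<open>Norm convergence of \<open>v (y n)\<close> to \<open>h\<close> implies weak
    convergence, and \<open>J'\<close> sends \<open>v (y n)\<close> to \<open>A (y n)\<close>; hence
    continuity and density determine \<open>J' h\<close>.\<close>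
  have unique: "pr (J' h) x = ip h (v x)" if J': "is_J J'" and h: "h \<in> H" for J' h x
  proof -
    obtain y where y: "(\<lambda>n. hnorm ip (v (y n) - h)) \<longlonglongrightarrow> 0" using v_dense_lim[OF h] by blast
    have "limitin (hweak H ip) (\<lambda>n. v (y n)) h sequentially"
      unfolding hweak_def using hw
      by (rule limitin_weak_topology_onI) (auto simp: iota_in h intro!: tendsto_ip_left y)
    then have "limitin (sigmaF pr) (J' \<circ> (\<lambda>n. v (y n))) (J' h) sequentially"
      using J' by (intro continuous_map_limit) (auto simp: is_J_def)
    then have "(\<lambda>n. pr (A (y n)) x) \<longlonglongrightarrow> pr (J' h) x"
      using limitin_sigmaF[of pr _ _ _ x] J' by (fastforce simp: is_J_def o_def)
    moreover have "(\<lambda>n. pr (A (y n)) x) \<longlonglongrightarrow> ip h (v x)"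
      using tendsto_ip_left[OF iota_in h iota_in y, of x] by (simp add: iota_isometric)
    ultimately show ?thesis using LIMSEQ_unique by blast
  qed
  have "is_J J0"
    unfolding is_J_def
  proof (intro conjI ballI allI J0(1))
    show "J0 (h + k) = J0 h + J0 k" if "h \<in> H" "k \<in> H" for h k
      using that by (intro antidual_pair_ext[OF pair])
        (simp add: antidual_pair_simps[OF pair] J0(2) H_closed ip_add_left iota_in)
    show "J0 (c *\<^sub>C h) = c *\<^sub>C J0 h" if "h \<in> H" for c h
      using that by (intro antidual_pair_ext[OF pair])
        (simp add: antidual_pair_simps[OF pair] J0(2) H_closed ip_scale_left iota_in)
    show "J0 (\<iota> f) = f" if "f \<in> range A" for f
      using that by (intro antidual_pair_ext[OF pair]) (auto simp: J0(2) iota_in iota_isometric)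
    have top: "topspace (hweak H ip) = H" unfolding hweak_def by (rule topspace_weak_topology_on[OF hw])
    show "continuous_map (hweak H ip) (sigmaF pr) J0"
      unfolding sigmaF_def
    proof (rule continuous_map_into_weak_topology_on)
      fix \<phi> assume "\<phi> \<in> range (\<lambda>x f. pr f x)"
      then obtain x where \<phi>: "\<phi> = (\<lambda>f. pr f x)" by blast
      have "continuous_map (hweak H ip) euclidean (\<lambda>h. ip h (v x))"
        unfolding hweak_def by (rule continuous_map_weak_topology_on) (auto simp: iota_in)
      then show "continuous_map (hweak H ip) euclidean (\<lambda>h. \<phi> (J0 h))"
        by (rule continuous_map_eq) (simp add: top \<phi> J0(2))
    qed auto
  qed
  moreover have "J' = J0" if J': "is_J J'" for J'
  proof (rule extensionalityI)
    show "J' \<in> extensional H" using J' by (simp add: is_J_def)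
    show "J' h = J0 h" if "h \<in> H" for h
      using unique[OF J' that] J0(2)[OF that] by (intro antidual_pair_ext[OF pair]) simp
  qed (rule J0(1))
  ultimately have "(THE J. is_J J) = J0" by (rule the_equality)
  then have "J = J0" unfolding J_op_def is_J_def .
  then show ?thesis using J0(2)[OF assms] by simp
qed

text \<open>The formula for \<open>pr (J h) x\<close> already displays \<open>v x\<close> as an
  adjoint vector; definiteness of the inner product makes it the only one.\<close>

lemma adjoint_J: "adjoint_op pr H ip J x = v x"
  unfolding adjoint_op_def
proof (rule the_equality)
  show "v x \<in> H \<and> (\<forall>h\<in>H. pr (J h) x = ip h (v x))" by (simp add: iota_in pr_J)
  fix g assume g: "g \<in> H \<and> (\<forall>h\<in>H. pr (J h) x = ip h g)"
  show "g = v x"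
  proof (rule ip_ext)
    show "ip g l = ip (v x) l" if "l \<in> H" for l
    proof -
      have "ip l g = ip l (v x)" using g that pr_J[of l x] by simp
      then show ?thesis using ip_commute[of g l] ip_commute[of "v x" l] g that iota_in by simp
    qed
  qed (use g iota_in in auto)
qed

end

section \<open>The Lebesgue decomposition\<close>

locale positive_completion_pair =
  a: positive_completion pr A HA ipA \<iota>A + b: positive_completion pr B HB ipB \<iota>B
  for pr :: "'f::complex_vector \<Rightarrow> 'e::complex_vector \<Rightarrow> complex"
    and A B :: "'e \<Rightarrow> 'f"
    and HA :: "'a::complex_vector set" and ipA and \<iota>A :: "'f \<Rightarrow> 'a"
    and HB :: "'b::complex_vector set" and ipB and \<iota>B :: "'f \<Rightarrow> 'b"
begin

section \<open>The space M as a closed subspace\<close>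

abbreviation "M \<equiv> M_space A HA ipA \<iota>A B HB ipB \<iota>B"

text \<open>Products of balls form a neighbourhood base at \<open>(0, \<xi>)\<close>, and the norm
  of \<open>a.v x\<close> is \<open>form_norm pr A x\<close>. The closure in the product thus
  becomes approximation with a single \<open>e\<close>.\<close>

lemma M_iff:
  "\<xi> \<in> M \<longleftrightarrow> \<xi> \<in> HB \<and> (\<forall>e>0. \<exists>x. form_norm pr A x < e \<and> hnorm ipB (\<xi> - b.v x) < e)"
    (is "_ \<longleftrightarrow> _ \<and> ?approx")
proof -
  have "(0, \<xi>) \<in> prod_topology (htopology HA ipA) (htopology HB ipB)
      closure_of range (\<lambda>x. (a.v x, b.v x)) \<longleftrightarrow> ?approx" if \<xi>: "\<xi> \<in> HB"
  proof
    assume cl: "(0, \<xi>) \<in> prod_topology (htopology HA ipA) (htopology HB ipB)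
      closure_of range (\<lambda>x. (a.v x, b.v x))"
    show ?approx
    proof (intro allI impI)
      fix e :: real assume "e > 0"
      let ?U = "{k \<in> HA. hnorm ipA (0 - k) < e}" and ?V = "{k \<in> HB. hnorm ipB (\<xi> - k) < e}"
      have "openin (prod_topology (htopology HA ipA) (htopology HB ipB)) (?U \<times> ?V)"
        using a.openin_htopology_ball[of 0 e] b.openin_htopology_ball[OF \<xi>, of e] a.H_closed(1)
        by (simp add: openin_prod_Times_iff)
      moreover have "(0, \<xi>) \<in> ?U \<times> ?V"
        using \<open>e > 0\<close> \<xi> a.H_closed(1) by (simp add: a.hnorm_zero b.hnorm_zero)
      ultimately have "\<exists>z. z \<in> range (\<lambda>x. (a.v x, b.v x)) \<and> z \<in> ?U \<times> ?V"
        using conjunct2[OF cl[unfolded in_closure_of], rule_format, of "?U \<times> ?V"] by simp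
      then obtain x where "(a.v x, b.v x) \<in> ?U \<times> ?V" by fast
      then show "\<exists>x. form_norm pr A x < e \<and> hnorm ipB (\<xi> - b.v x) < e"
        by (auto simp: a.hnorm_minus a.iota_in a.hnorm_v)
    qed
  next
    assume ap: ?approx
    show "(0, \<xi>) \<in> prod_topology (htopology HA ipA) (htopology HB ipB)
      closure_of range (\<lambda>x. (a.v x, b.v x))"
      unfolding in_closure_of
    proof (intro conjI allI impI)
      show "(0, \<xi>) \<in> topspace (prod_topology (htopology HA ipA) (htopology HB ipB))"
        by (simp add: a.topspace_htopology b.topspace_htopology \<xi> a.H_closed)
      fix T assume "(0, \<xi>) \<in> T \<and> openin (prod_topology (htopology HA ipA) (htopology HB ipB)) T"
      then obtain U V where UV: "openin (htopology HA ipA) U" "openin (htopology HB ipB) V"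
        "0 \<in> U" "\<xi> \<in> V" "U \<times> V \<subseteq> T"
        unfolding openin_prod_topology_alt by blast
      obtain d where d: "d > 0" "\<And>k. k \<in> HA \<Longrightarrow> hnorm ipA (0 - k) < d \<Longrightarrow> k \<in> U"
        using a.htopology_openE[OF UV(1,3)] by blast
      obtain e where e: "e > 0" "\<And>k. k \<in> HB \<Longrightarrow> hnorm ipB (\<xi> - k) < e \<Longrightarrow> k \<in> V"
        using b.htopology_openE[OF UV(2,4)] by blast
      obtain x where "form_norm pr A x < min d e" "hnorm ipB (\<xi> - b.v x) < min d e"
        using ap[rule_format, of "min d e"] d(1) e(1) by auto
      then have "(a.v x, b.v x) \<in> T"
        using d(2)[of "a.v x"] e(2)[of "b.v x"] UV(5)
        by (auto simp: a.hnorm_minus a.iota_in b.iota_in a.hnorm_v)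
      then show "\<exists>y. y \<in> range (\<lambda>x. (a.v x, b.v x)) \<and> y \<in> T" by blast
    qed
  qed
  then show ?thesis unfolding M_space_def by blast
qed

lemma M_approx:
  assumes "\<xi> \<in> M" "e > 0"
  obtains x where "form_norm pr A x < e" "hnorm ipB (\<xi> - b.v x) < e"
  using assms M_iff[of \<xi>] that by fast

lemma M_seq:
  assumes "\<xi> \<in> M"
  obtains x where "\<And>n::nat. form_norm pr A (x n) < 1 / real (Suc n)"
    "\<And>n::nat. hnorm ipB (\<xi> - b.v (x n)) < 1 / real (Suc n)"
proof -
  have "\<exists>x. form_norm pr A x < 1 / real (Suc n) \<and> hnorm ipB (\<xi> - b.v x) < 1 / real (Suc n)" for n
    by (rule M_approx[OF assms, of "1 / real (Suc n)"]) auto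
  then have "\<forall>n. \<exists>x. form_norm pr A x < 1 / real (Suc n) \<and> hnorm ipB (\<xi> - b.v x) < 1 / real (Suc n)"
    by blast
  from choice[OF this] obtain x where
    "\<forall>n. form_norm pr A (x n) < 1 / real (Suc n) \<and> hnorm ipB (\<xi> - b.v (x n)) < 1 / real (Suc n)" ..
  then show ?thesis by (intro that[of x]) simp_all
qed

sublocale fA: complex_semi_inner_space UNIV "\<lambda>x. pr (A x)"
  by (rule positive_op_semi_inner_space[OF a.pair a.pos])

text \<open>Approximants of vectors in \<open>M\<close> can be added and scaled, and an approximant
  of a nearby element of \<open>M\<close> serves a limit point as well. From here on
  \<open>b.P\<close> is the projection onto \<open>M\<close>.\<close>

sublocale b: hilbert_closed_subspace HB ipB M
proof
  show "complex_vector.subspace M"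
  proof (rule complex_vector.subspaceI)
    have "b.v 0 = 0" using b.v_lin(3)[of 0 0] by simp
    then show "0 \<in> M"
      unfolding M_iff
      by (auto simp: b.H_closed fA.hnorm_zero b.hnorm_zero intro!: exI[of _ 0])
  next
    fix \<xi> \<eta> assume \<xi>: "\<xi> \<in> M" and \<eta>: "\<eta> \<in> M"
    have H: "\<xi> \<in> HB" "\<eta> \<in> HB" using \<xi> \<eta> by (auto simp: M_iff)
    show "\<xi> + \<eta> \<in> M"
      unfolding M_iff
    proof (intro conjI allI impI)
      fix e :: real assume "e > 0"
      then have "e / 2 > 0" by simp
      obtain x where x: "form_norm pr A x < e / 2" "hnorm ipB (\<xi> - b.v x) < e / 2"
        by (rule M_approx[OF \<xi> \<open>e / 2 > 0\<close>])
      obtain y where y: "form_norm pr A y < e / 2" "hnorm ipB (\<eta> - b.v y) < e / 2"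
        by (rule M_approx[OF \<eta> \<open>e / 2 > 0\<close>])
      have eq: "\<xi> + \<eta> - b.v (x + y) = (\<xi> - b.v x) + (\<eta> - b.v y)" by (simp add: b.v_lin)
      have "hnorm ipB (\<xi> + \<eta> - b.v (x + y)) < e"
        unfolding eq using b.hnorm_triangle[of "\<xi> - b.v x" "\<eta> - b.v y"] x y H
        by (simp add: b.H_closed b.iota_in)
      moreover have "form_norm pr A (x + y) < e" using fA.hnorm_triangle[of x y] x y by simp
      ultimately show "\<exists>x. form_norm pr A x < e \<and> hnorm ipB (\<xi> + \<eta> - b.v x) < e" by blast
    qed (use H in \<open>simp add: b.H_closed\<close>)
    show "c *\<^sub>C \<xi> \<in> M" for c
      unfolding M_iff
    proof (intro conjI allI impI)
      fix e :: real assume "e > 0"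
      \<comment> \<open>The summand 1 keeps the denominator positive when
        \<open>c = 0\<close>.\<close>
      define d where "d = e / (cmod c + 1)"
      have c: "cmod c + 1 > 0" by (simp add: add_nonneg_pos)
      then have "d > 0" using \<open>e > 0\<close> by (simp add: d_def)
      obtain x where x: "form_norm pr A x < d" "hnorm ipB (\<xi> - b.v x) < d"
        by (rule M_approx[OF \<xi> \<open>d > 0\<close>])
      have "cmod c * t < e" if "t < d" "t \<ge> 0" for t
      proof -
        have "cmod c * t \<le> (cmod c + 1) * t" using that by (intro mult_right_mono) auto
        also have "\<dots> < e" using that(1) c by (simp add: d_def field_simps)
        finally show ?thesis .
      qed
      moreover have "c *\<^sub>C \<xi> - b.v (c *\<^sub>C x) = c *\<^sub>C (\<xi> - b.v x)"
        by (simp add: b.v_lin complex_vector.scale_right_diff_distrib)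
      ultimately have "form_norm pr A (c *\<^sub>C x) < e" "hnorm ipB (c *\<^sub>C \<xi> - b.v (c *\<^sub>C x)) < e"
        using x H(1) by (simp_all add: fA.hnorm_scale b.hnorm_scale fA.hnorm_nonneg
            b.hnorm_nonneg b.H_closed b.iota_in)
      then show "\<exists>x. form_norm pr A x < e \<and> hnorm ipB (c *\<^sub>C \<xi> - b.v x) < e" by blast
    qed (use H in \<open>simp add: b.H_closed\<close>)
  qed
  show "M \<subseteq> HB" by (auto simp: M_iff)
  fix h assume h: "h \<in> HB" and *: "\<And>e. e > 0 \<Longrightarrow> \<exists>m\<in>M. hnorm ipB (h - m) < e"
  show "h \<in> M"
    unfolding M_iff
  proof (intro conjI allI impI h)
    fix e :: real assume "e > 0"
    then have e2: "e / 2 > 0" by simp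
    obtain m where m: "m \<in> M" "hnorm ipB (h - m) < e / 2" using *[OF e2] by blast
    have mH: "m \<in> HB" using m(1) M_iff by blast
    obtain x where x: "form_norm pr A x < e / 2" "hnorm ipB (m - b.v x) < e / 2"
      by (rule M_approx[OF m(1) e2])
    have "hnorm ipB (h - b.v x) < e"
      using b.hnorm_diff_triangle[of h m "b.v x"] h m mH x by (simp add: b.iota_in)
    moreover have "form_norm pr A x < e" using x(1) \<open>e > 0\<close> by simp
    ultimately show "\<exists>x. form_norm pr A x < e \<and> hnorm ipB (h - b.v x) < e" by blast
  qed
qed

section \<open>The two parts of B and their quadratic forms\<close>

definition Ba where "Ba x = b.J (b.v x - b.P (b.v x))"
definition Bs where "Bs x = b.J (b.P (b.v x))"

lemma pr_Ba: "pr (Ba x) y = ipB (b.v x - b.P (b.v x)) (b.v y)"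
  by (simp add: Ba_def b.pr_J b.H_closed b.iota_in b.P_in_H)

lemma pr_Bs: "pr (Bs x) y = ipB (b.P (b.v x)) (b.v y)"
  by (simp add: Bs_def b.pr_J b.iota_in b.P_in_H)

lemma form_norm_Ba: "form_norm pr Ba x = hnorm ipB (b.v x - b.P (b.v x))"
  by (simp add: hnorm_def pr_Ba b.ip_P_compl_self b.iota_in)

lemma form_norm_Bs: "form_norm pr Bs x = hnorm ipB (b.P (b.v x))"
  by (simp add: hnorm_def pr_Bs b.ip_P_self b.iota_in)

lemma decomposition: "B x = Ba x + Bs x"
  by (rule antidual_pair_ext[OF a.pair])
    (simp add: antidual_pair_simps[OF a.pair] pr_Ba pr_Bs b.ip_diff_left b.iota_in b.P_in_H
      b.iota_isometric)

lemma positive_Ba: "positive_op pr Ba"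
  unfolding positive_op_def
proof (intro conjI allI)
  show "clinear Ba"
    by (rule clinear_antidual_pairI[OF a.pair])
      (simp_all add: pr_Ba b.v_lin b.P_add b.P_scale b.ip_diff_left b.ip_add_left b.ip_scale_left
        b.iota_in b.P_in_H b.H_closed algebra_simps)
  show "pr (Ba x) x \<in> \<real>\<^sub>\<ge>\<^sub>0" for x
    by (simp add: pr_Ba b.ip_P_compl_self b.iota_in b.ip_self b.P_in_H b.H_closed)
qed

lemma positive_Bs: "positive_op pr Bs"
  unfolding positive_op_def
proof (intro conjI allI)
  show "clinear Bs"
    by (rule clinear_antidual_pairI[OF a.pair])
      (simp_all add: pr_Bs b.v_lin b.P_add b.P_scale b.ip_add_left b.ip_scale_left
        b.iota_in b.P_in_H)
  show "pr (Bs x) x \<in> \<real>\<^sub>\<ge>\<^sub>0" for x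
    by (simp add: pr_Bs b.ip_P_self b.iota_in b.ip_self b.P_in_H)
qed

section \<open>Absolute continuity, singularity and maximality\<close>

text \<open>The limit of \<open>(I - P) B x\<^sub>n\<close> lies both in \<open>M\<close> and in its orthogonal complement: it lies in \<open>M\<close>
  because each \<open>P B x\<^sub>n\<close> can be cancelled by some \<open>B y\<close> with \<open>A y\<close> small.\<close>

lemma abs_cont_Ba: "abs_cont pr Ba A"
  unfolding abs_cont_iff[OF a.pair a.pos positive_Ba]
proof (intro allI impI, elim conjE)
  fix x :: "nat \<Rightarrow> 'e"
  assume A0: "(\<lambda>n. form_norm pr A (x n)) \<longlonglongrightarrow> 0"
    and C: "\<forall>e>0. \<exists>N. \<forall>m\<ge>N. \<forall>n\<ge>N. form_norm pr Ba (x m - x n) < e"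
  define q where "q n = b.v (x n) - b.P (b.v (x n))" for n
  have qH: "q n \<in> HB" for n by (simp add: q_def b.H_closed b.iota_in b.P_in_H)
  have "form_norm pr Ba (x m - x n) = hnorm ipB (q m - q n)" for m n
    by (simp add: form_norm_Ba q_def b.v_lin b.P_diff b.iota_in algebra_simps)
  with C have "\<And>e. e > 0 \<Longrightarrow> \<exists>N. \<forall>m\<ge>N. \<forall>n\<ge>N. hnorm ipB (q m - q n) < e" by simp
  from b.Cauchy_limit[OF qH this] obtain \<eta> where \<eta>: "\<eta> \<in> HB" "(\<lambda>n. hnorm ipB (q n - \<eta>)) \<longlonglongrightarrow> 0"
    by blast
  have "\<eta> \<in> M"
    unfolding M_iff
  proof (intro conjI allI impI \<eta>(1))
    fix e :: real assume "e > 0"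
    then have e2: "e / 2 > 0" by simp
    have "\<forall>\<^sub>F n in sequentially. form_norm pr A (x n) < e / 2 \<and> hnorm ipB (q n - \<eta>) < e / 2"
      by (intro eventually_conj order_tendstoD(2)[OF A0 e2] order_tendstoD(2)[OF \<eta>(2) e2])
    then obtain n where n: "form_norm pr A (x n) < e / 2" "hnorm ipB (q n - \<eta>) < e / 2"
      using eventually_happens'[OF sequentially_bot] by blast
    have "b.P (b.v (x n)) \<in> M" by (simp add: b.P_in_M b.iota_in)
    from M_approx[OF this e2] obtain y where y: "form_norm pr A y < e / 2"
      "hnorm ipB (b.P (b.v (x n)) - b.v y) < e / 2" .
    have "form_norm pr A (x n - y) < e"
      using fA.hnorm_triangle[of "x n" "- y"] fA.hnorm_minus[of y] n(1) y(1) by simp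
    \<comment> \<open>Since \<open>b.v (x n)\<close> is \<open>q n\<close> plus its projection, the
      error splits into the distance from \<open>q n\<close> to the limit and the error of
      approximating the projection by \<open>b.v y\<close>.\<close>
    moreover have eq: "\<eta> - b.v (x n - y) = (\<eta> - q n) - (b.P (b.v (x n)) - b.v y)"
      by (simp add: q_def b.v_lin)
    have "hnorm ipB (\<eta> - b.v (x n - y)) < e"
      unfolding eq using b.hnorm_diff_triangle[of "\<eta> - q n" 0 "b.P (b.v (x n)) - b.v y"] n(2) y(2) \<eta>(1) qH
        b.hnorm_minus[of "b.P (b.v (x n)) - b.v y"] b.hnorm_diff_commute[of \<eta> "q n"]
      by (simp add: b.H_closed b.iota_in b.P_in_H)
    ultimately show "\<exists>z. form_norm pr A z < e \<and> hnorm ipB (\<eta> - b.v z) < e" by blast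
  qed
  then have "ipB (q n) \<eta> = 0" for n by (simp add: q_def b.P_orth b.iota_in)
  then have "ipB \<eta> \<eta> = 0"
    using b.tendsto_ip_left[OF qH \<eta>(1) \<eta>(1) \<eta>(2)] by (simp add: LIMSEQ_const_iff)
  then have "\<eta> = 0" by (rule b.ip_definite[OF \<eta>(1)])
  then show "(\<lambda>n. form_norm pr Ba (x n)) \<longlonglongrightarrow> 0"
    using \<eta>(2) by (simp add: form_norm_Ba q_def)
qed

text \<open>Write \<open>x = (x - y) + y\<close> with \<open>form_norm pr A y\<close> small and
  \<open>b.v y\<close> near \<open>b.P (b.v x)\<close>: the bound by \<open>A\<close> controls
  \<open>y\<close>, the bound by \<open>Bs\<close> controls \<open>x - y\<close>.\<close>

lemma singular_Bs: "singular_op pr A Bs"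
  unfolding singular_op_def
proof (intro ballI impI, elim conjE)
  fix C assume C: "positive_op pr C" "op_le pr C A" "op_le pr C Bs"
  interpret C: complex_semi_inner_space UNIV "\<lambda>x. pr (C x)"
    by (rule positive_op_semi_inner_space[OF a.pair C(1)])
  have "form_norm pr C x \<le> 0" for x
  proof (rule field_le_epsilon)
    fix e :: real assume "e > 0"
    then have e2: "e / 2 > 0" by simp
    have M: "b.P (b.v x) \<in> M" by (simp add: b.P_in_M b.iota_in)
    obtain y where y: "form_norm pr A y < e / 2" "hnorm ipB (b.P (b.v x) - b.v y) < e / 2"
      by (rule M_approx[OF M e2])
    \<comment> \<open>The projection fixes \<open>b.P (b.v x)\<close>, so the
      \<open>Bs\<close>-seminorm of \<open>x - y\<close> is the norm of a projected approximation
      error.\<close>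
    have "b.P (b.v (x - y)) = b.P (b.P (b.v x) - b.v y)"
      using b.P_id[OF M] by (simp add: b.v_lin b.P_diff b.P_in_H b.iota_in)
    then have "form_norm pr Bs (x - y) \<le> hnorm ipB (b.P (b.v x) - b.v y)"
      by (simp add: form_norm_Bs b.hnorm_P_le b.P_in_H b.iota_in b.H_closed)
    then have "form_norm pr C (x - y) < e / 2"
      using form_norm_mono[OF a.pair C(3), of "x - y"] y(2) by linarith
    moreover have "form_norm pr C y < e / 2"
      using form_norm_mono[OF a.pair C(2), of y] y(1) by linarith
    ultimately show "form_norm pr C x \<le> 0 + e" using C.hnorm_triangle[of "x - y" y] by simp
  qed
  then show "C = (\<lambda>x. 0)"
    using C.hnorm_nonneg by (intro positive_op_eq_0[OF a.pair C(1)]) (auto intro: antisym)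
qed

text \<open>A sequence \<open>y\<close> with \<open>form_norm pr A (y n)\<close> tending to 0 and
  \<open>b.v (y n)\<close> tending to \<open>b.P (b.v x)\<close> is Cauchy for \<open>D\<close>,
  since \<open>D\<close> is below \<open>B\<close>; absolute continuity makes it null for
  \<open>D\<close>, so subtracting it from \<open>x\<close> leaves the \<open>D\<close>-seminorm
  unchanged in the limit.\<close>

lemma Ba_greatest:
  assumes D: "positive_op pr D" "op_le pr D B" "abs_cont pr D A"
  shows "op_le pr D Ba"
proof (rule op_leI[OF a.pair D(1) positive_Ba])
  fix x
  interpret D: complex_semi_inner_space UNIV "\<lambda>x. pr (D x)"
    by (rule positive_op_semi_inner_space[OF a.pair D(1)])
  have DB: "form_norm pr D z \<le> hnorm ipB (b.v z)" for z
    using form_norm_mono[OF a.pair D(2)] by (simp add: b.hnorm_v)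
  define p where "p = b.P (b.v x)"
  have p: "p \<in> M" "p \<in> HB" by (simp_all add: p_def b.P_in_M b.P_in_H b.iota_in)
  obtain y where y: "\<And>n::nat. form_norm pr A (y n) < 1 / real (Suc n)"
    "\<And>n::nat. hnorm ipB (p - b.v (y n)) < 1 / real (Suc n)"
    using M_seq[OF p(1)] by blast
  have null: "r \<longlonglongrightarrow> 0" if "\<And>n. 0 \<le> r n" "\<And>n. r n < 1 / real (Suc n)" for r :: "nat \<Rightarrow> real"
  proof (rule Lim_null_comparison[OF always_eventually LIMSEQ_Suc[OF lim_1_over_n]], rule allI)
    show "norm (r n) \<le> 1 / real (Suc n)" for n using that[of n] by simp
  qed
  have A0: "(\<lambda>n. form_norm pr A (y n)) \<longlonglongrightarrow> 0" using y(1) by (intro null) (auto simp: fA.hnorm_nonneg)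
  have p0: "(\<lambda>n. hnorm ipB (p - b.v (y n))) \<longlonglongrightarrow> 0"
    using y(2) p by (intro null) (auto simp: b.hnorm_nonneg b.H_closed b.iota_in)
  have "\<exists>N. \<forall>m\<ge>N. \<forall>n\<ge>N. form_norm pr D (y m - y n) < e" if "e > 0" for e
  proof -
    have e2: "e / 2 > 0" using that by simp
    obtain N where N: "\<And>n. n \<ge> N \<Longrightarrow> hnorm ipB (p - b.v (y n)) < e / 2"
      using order_tendstoD(2)[OF p0 e2] unfolding eventually_sequentially by blast
    have "form_norm pr D (y m - y n) < e" if "m \<ge> N" "n \<ge> N" for m n
      using DB[of "y m - y n"] N[OF that(1)] N[OF that(2)] p
        b.hnorm_diff_triangle[of "b.v (y m)" p "b.v (y n)"] b.hnorm_diff_commute[of p "b.v (y m)"]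
      by (simp add: b.v_lin b.iota_in)
    then show ?thesis by blast
  qed
  then have D0: "(\<lambda>n. form_norm pr D (y n)) \<longlonglongrightarrow> 0"
    using D(3) A0 unfolding abs_cont_iff[OF a.pair a.pos D(1)] by blast
  \<comment> \<open>Split \<open>x\<close> into \<open>x - y n\<close> and \<open>y n\<close>, bound
    the first by the norm of its image under \<open>b.v\<close>, and insert \<open>p\<close>. Only
    the first summand survives the limit, and it is the \<open>Ba\<close>-seminorm of
    \<open>x\<close>.\<close>
  have "form_norm pr D x \<le> hnorm ipB (b.v x - p) + hnorm ipB (p - b.v (y n)) + form_norm pr D (y n)" for n
    using D.hnorm_triangle[of "x - y n" "y n"] DB[of "x - y n"] p
      b.hnorm_diff_triangle[of "b.v x" p "b.v (y n)"]
    by (simp add: b.v_lin b.iota_in)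
  then have "\<exists>N. \<forall>n\<ge>N. form_norm pr D x
      \<le> hnorm ipB (b.v x - p) + hnorm ipB (p - b.v (y n)) + form_norm pr D (y n)"
    by blast
  moreover have "(\<lambda>n. hnorm ipB (b.v x - p) + hnorm ipB (p - b.v (y n)) + form_norm pr D (y n))
      \<longlonglongrightarrow> hnorm ipB (b.v x - p) + 0 + 0"
    by (intro tendsto_intros p0 D0)
  ultimately have "form_norm pr D x \<le> hnorm ipB (b.v x - p) + 0 + 0"
    by (intro LIMSEQ_le_const)
  then show "form_norm pr D x \<le> form_norm pr Ba x" by (simp add: form_norm_Ba p_def)
qed

end

theorem theorem3p3:
  fixes pr :: "'f::complex_vector \<Rightarrow> 'e::complex_vector \<Rightarrow> complex"
    and A B Ba Bs :: "'e \<Rightarrow> 'f"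
    and HA :: "'a::complex_vector set" and ipA :: "'a \<Rightarrow> 'a \<Rightarrow> complex" and \<iota>A :: "'f \<Rightarrow> 'a"
    and HB :: "'b::complex_vector set" and ipB :: "'b \<Rightarrow> 'b \<Rightarrow> complex" and \<iota>B :: "'f \<Rightarrow> 'b"
    and P :: "'b \<Rightarrow> 'b" and JB :: "'b \<Rightarrow> 'f" and JB_adj :: "'e \<Rightarrow> 'b"
  assumes "antidual_pair pr" and "weak_star_sequentially_complete pr"
    and "positive_op pr A" and "positive_op pr B"
    and "hilbert_completion pr A HA ipA \<iota>A" and "hilbert_completion pr B HB ipB \<iota>B"
  defines "P \<equiv> orth_proj ipB (M_space A HA ipA \<iota>A B HB ipB \<iota>B)"
    and "JB \<equiv> J_op pr B HB ipB \<iota>B"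
    and "JB_adj \<equiv> adjoint_op pr HB ipB JB"
    and "Ba \<equiv> (\<lambda>x. JB (JB_adj x - P (JB_adj x)))"
    and "Bs \<equiv> (\<lambda>x. JB (P (JB_adj x)))"
  shows "positive_op pr Ba \<and> positive_op pr Bs \<and> B = (\<lambda>x. Ba x + Bs x) \<and>
    abs_cont pr Ba A \<and> singular_op pr A Bs \<and>
    Ba \<in> {C \<in> weak_operators pr. positive_op pr C \<and> op_le pr C B \<and> abs_cont pr C A} \<and>
    (\<forall>D \<in> {C \<in> weak_operators pr. positive_op pr C \<and> op_le pr C B \<and> abs_cont pr C A}. op_le pr D Ba)"
proof -
  interpret a: hilbert_completion pr A HA ipA \<iota>A by fact
  interpret b: hilbert_completion pr B HB ipB \<iota>B by fact
  interpret L: positive_completion_pair pr A B HA ipA \<iota>A HB ipB \<iota>B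
    by unfold_locales fact+
  \<comment> \<open>Replacing the adjoint by its explicit value identifies the operators of the
    statement with those of the locale.\<close>
  have "JB_adj x = \<iota>B (B x)" for x unfolding JB_adj_def JB_def by (rule L.b.adjoint_J)
  then have eq: "Ba = L.Ba" "Bs = L.Bs"
    unfolding Ba_def Bs_def L.Ba_def L.Bs_def fun_eq_iff P_def JB_def by simp_all
  have "B = (\<lambda>x. L.Ba x + L.Bs x)" using L.decomposition by blast
  \<comment> \<open>The difference of \<open>B\<close> and \<open>L.Ba\<close> is
    \<open>L.Bs\<close>, which is positive.\<close>
  moreover have "op_le pr L.Ba B"
    using L.positive_Bs by (simp add: op_le_def L.decomposition)
  moreover have "L.Ba \<in> weak_operators pr"
    using L.positive_Ba by (rule positive_op_weak_operators[OF \<open>antidual_pair pr\<close>])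
  ultimately show ?thesis
    unfolding eq using L.positive_Ba L.positive_Bs L.abs_cont_Ba L.singular_Bs L.Ba_greatest
    by (intro conjI ballI) auto
qed

end
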